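(* Let $\alpha$ be a continuous rotationally symmetric norm on $L^\infty(\mathbb T)$. Then $H^\alpha(\mathbb T)=L^\alpha(\mathbb T)\cap H^1(\mathbb T)$.
   Context: $\mathbb T$ is the unit circle and $m$ is normalized arc length (Haar measure) on $\mathbb T$; functions equal a.e. are identified. For $w\in\mathbb T$, $f_w(z)=f(\overline wz)$. A continuous rotationally symmetric norm is a norm $\alpha$ on $L^\infty(\mathbb T)$ with $\alpha(1)=1$, $\alpha(|f|)=\alpha(f)$, $\alpha(f_w)=\alpha(f)$ for all $f\in L^\infty(\mathbb T)$, $w\in\mathbb T$, and $\lim_{m(E)\to0^+}\alpha(\chi_E)=0$. For any measurable $f:\mathbb T\to\mathbb C$ put $\alpha(f)=\sup\{\alpha(s):s\text{ a simple function},\ |s|\le|f|\}$. $\mathcal L^\alpha(\mathbb T)$ is the set of measurable $f$ with $\alpha(f)<\infty$, and $L^\alpha(\mathbb T)$ is the $\alpha$-closure of $L^\infty(\mathbb T)$ in $\mathcal L^\alpha(\mathbb T)$. $H^\alpha(\mathbb T)$ is the $\alpha$-closed linear span of $\{1,z,z^2,\ldots\}$. $H^1(\mathbb T)=\{F\in L^1(\mathbb T):\int_{\mathbb T}F(z)z^{-n}\,dm(z)=0\text{ for all }n<0\}$. *)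

theory Defs
  imports "HOL-Analysis.Analysis"
begin

text \<open>
  Functions on the circle are total functions on the complex plane; their values off
  \<^term>\<open>sphere 0 1\<close> play no role, since every notion below refers only to values almost
  everywhere with respect to \<open>circle\<close>.  Instead of classes of functions we use the functions
  themselves, so sets of classes become sets of functions closed under equality almost everywhere.
\<close>

definition circle :: "complex measure" where
  "circle = distr (uniform_measure lborel {0..<2 * pi}) (restrict_space borel (sphere 0 1)) cis"

lemma space_circle: "space circle = sphere 0 1"
  by (simp add: circle_def space_restrict_space)

lemma measurable_cis_circle:
  "cis \<in> measurable (uniform_measure lborel {0..<2 * pi}) (restrict_space borel (sphere 0 1))"
proof (rule measurable_restrict_space2)
  show "cis \<in> space (uniform_measure lborel {0..<2 * pi}) \<rightarrow> sphere 0 1"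
    by auto
  have "cis \<in> borel_measurable borel"
    by (intro borel_measurable_continuous_onI continuous_intros)
  then show "cis \<in> borel_measurable (uniform_measure lborel {0..<2 * pi})"
    by simp
qed

lemma emeasure_circle_space: "emeasure circle (sphere 0 1) = 1"
proof -
  have "cis -` sphere 0 1 = UNIV"
    by auto
  moreover have "sphere 0 1 \<in> sets (restrict_space borel (sphere 0 1 :: complex set))"
    using sets.top[of "restrict_space borel (sphere 0 1 :: complex set)"]
    by (simp add: space_restrict_space)
  ultimately have "emeasure circle (sphere 0 1) = emeasure (uniform_measure lborel {0..<2 * pi}) UNIV"
    unfolding circle_def
    by (subst emeasure_distr[OF measurable_cis_circle]) simp_all
  also have "\<dots> = 1"
    by (subst emeasure_uniform_measure) (auto simp: ennreal_divide_self)
  finally show ?thesis .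
qed

definition L_infinity :: "(complex \<Rightarrow> complex) set" where
  "L_infinity = {f \<in> borel_measurable circle. \<exists>C. AE z in circle. cmod (f z) \<le> C}"

text \<open>
  Definiteness is stated up to null functions; with the triangle inequality it makes
  \<open>\<alpha>\<close> respect equality almost everywhere on \<^term>\<open>L_infinity\<close>.
  Nothing is assumed about \<open>\<alpha>\<close> outside \<^term>\<open>L_infinity\<close>.
\<close>

definition norm_on_L_infinity :: "((complex \<Rightarrow> complex) \<Rightarrow> real) \<Rightarrow> bool" where
  "norm_on_L_infinity \<alpha> \<longleftrightarrow>
     (\<forall>f\<in>L_infinity. 0 \<le> \<alpha> f) \<and>
     (\<forall>f\<in>L_infinity. \<alpha> f = 0 \<longleftrightarrow> (AE z in circle. f z = 0)) \<and>
     (\<forall>f\<in>L_infinity. \<forall>c. \<alpha> (\<lambda>z. c * f z) = cmod c * \<alpha> f) \<and>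
     (\<forall>f\<in>L_infinity. \<forall>g\<in>L_infinity. \<alpha> (\<lambda>z. f z + g z) \<le> \<alpha> f + \<alpha> g)"

definition continuous_rotationally_symmetric_norm ::
    "((complex \<Rightarrow> complex) \<Rightarrow> real) \<Rightarrow> bool" where
  "continuous_rotationally_symmetric_norm \<alpha> \<longleftrightarrow>
     norm_on_L_infinity \<alpha> \<and>
     \<alpha> (\<lambda>z. 1) = 1 \<and>
     (\<forall>f\<in>L_infinity. \<alpha> (\<lambda>z. of_real (cmod (f z))) = \<alpha> f) \<and>
     (\<forall>f\<in>L_infinity. \<forall>w\<in>sphere 0 1. \<alpha> (\<lambda>z. f (cnj w * z)) = \<alpha> f) \<and>
     (\<forall>\<epsilon>>0. \<exists>\<delta>>0. \<forall>E\<in>sets circle.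
        0 < measure circle E \<and> measure circle E < \<delta> \<longrightarrow> \<alpha> (indicator E) < \<epsilon>)"

definition extended_norm ::
    "((complex \<Rightarrow> complex) \<Rightarrow> real) \<Rightarrow> (complex \<Rightarrow> complex) \<Rightarrow> ennreal" where
  "extended_norm \<alpha> f =
     (SUP s\<in>{s. simple_function circle s \<and> (AE z in circle. cmod (s z) \<le> cmod (f z))}.
        ennreal (\<alpha> s))"

definition script_L :: "((complex \<Rightarrow> complex) \<Rightarrow> real) \<Rightarrow> (complex \<Rightarrow> complex) set" where
  "script_L \<alpha> = {f \<in> borel_measurable circle. extended_norm \<alpha> f < \<infinity>}"

definition norm_closure ::
    "((complex \<Rightarrow> complex) \<Rightarrow> real) \<Rightarrow> (complex \<Rightarrow> complex) set \<Rightarrow> (complex \<Rightarrow> complex) set" where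
  "norm_closure \<alpha> S =
     {f \<in> script_L \<alpha>. \<forall>\<epsilon>>0. \<exists>g\<in>S. extended_norm \<alpha> (\<lambda>z. f z - g z) < ennreal \<epsilon>}"

definition L_alpha :: "((complex \<Rightarrow> complex) \<Rightarrow> real) \<Rightarrow> (complex \<Rightarrow> complex) set" where
  "L_alpha \<alpha> = norm_closure \<alpha> L_infinity"

definition complex_span :: "(complex \<Rightarrow> complex) set \<Rightarrow> (complex \<Rightarrow> complex) set" where
  "complex_span B = {(\<lambda>z. \<Sum>b\<in>F. c b * b z) | F c. finite F \<and> F \<subseteq> B}"

definition H_alpha :: "((complex \<Rightarrow> complex) \<Rightarrow> real) \<Rightarrow> (complex \<Rightarrow> complex) set" where
  "H_alpha \<alpha> = norm_closure \<alpha> (complex_span (range (\<lambda>n::nat. \<lambda>z. z ^ n)))"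

definition H_one :: "(complex \<Rightarrow> complex) set" where
  "H_one = {F. integrable circle F \<and> (\<forall>n::int. n < 0 \<longrightarrow> (LINT z|circle. F z * z powi (- n)) = 0)}"

end

theory Submission
  imports Defs
begin

text \<open>
  A norm that depends only on moduli is monotone, and with its continuity this makes trigonometric
  polynomials dense in \<open>L\<^sup>\<alpha>\<close>.  Averaging a trigonometric polynomial \<open>p\<close> over rotations by
  \<open>M\<close>-th roots of unity, with nonnegative weights of total mass 1, does not increase \<open>\<alpha>\<close>.
  Uniform weights give \<open>\<bar>\<integral> p\<bar> \<le> \<alpha>(p)\<close>, hence \<open>\<parallel>f\<parallel>\<^sub>1 \<le> \<alpha>(f)\<close> and the inclusion of \<open>H\<^sup>\<alpha>\<close> in
  \<open>H\<^sup>1\<close>; Fejer weights give \<open>\<alpha>(\<sigma>\<^sub>n p) \<le> \<alpha>(p)\<close> for the Cesaro means.  For \<open>f\<close> in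
  \<open>L\<^sup>\<alpha> \<inter> H\<^sup>1\<close> take a trigonometric polynomial \<open>p\<close> close to \<open>f\<close>, then \<open>n\<close> with \<open>\<sigma>\<^sub>n p\<close> close
  to \<open>p\<close>, and then a trigonometric polynomial \<open>q\<close> within \<open>\<epsilon>/n\<close> of \<open>f\<close>: the negative
  coefficients of \<open>q\<close> are so small that the analytic part of \<open>\<sigma>\<^sub>n q\<close> is close to \<open>f\<close>.
\<close>

section \<open>Characters and Fejer weights on the circle\<close>

lemma sets_circle: "sets circle = sets (restrict_space borel (sphere 0 1))"
  by (simp add: circle_def)

interpretation circle: finite_measure circle
  by standard (simp add: space_circle emeasure_circle_space)

lemma measure_circle_space [simp]: "measure circle (space circle) = 1"
  by (simp add: measure_def space_circle emeasure_circle_space)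

lemma borel_measurable_circle_continuous:
  "continuous_on (sphere 0 1) f \<Longrightarrow> f \<in> borel_measurable circle"
  using borel_measurable_continuous_on_restrict[of "sphere 0 1" f]
  by (simp add: measurable_cong_sets[OF sets_circle refl])

lemma sphere_nonzero: "z \<in> sphere 0 1 \<Longrightarrow> z \<noteq> (0::complex)"
  by auto

lemma continuous_on_circle_powi [continuous_intros]:
  "continuous_on (sphere 0 1) (\<lambda>z::complex. z powi j)"
  by (intro continuous_intros) auto

lemma circle_powi_add: "cmod z = 1 \<Longrightarrow> z powi (i + j) = z powi i * z powi j"
  by (subst power_int_add) auto

text \<open>After pulling back along \<open>cis\<close>, a character with
  \<open>j \<noteq> 0\<close> has a primitive that is itself periodic with period
  \<open>2 * pi\<close>, so its integral over one period vanishes.\<close>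

lemma integral_circle_powi:
  "(LINT z|circle. z powi j) = (if j = 0 then 1 else 0)"
proof (cases "j = 0")
  case True
  then show ?thesis by (simp)
next
  case False
  have 1: "(\<lambda>z::complex. z powi j) \<in> borel_measurable (restrict_space borel (sphere 0 1))"
    using borel_measurable_continuous_on_restrict continuous_on_circle_powi by blast
  define F where "F x = cis (j * x) / (2 * pi * (\<i> * j))" for x :: real
  have cis_meas: "(\<lambda>x. cis (of_int j * x)) \<in> borel_measurable borel"
    by (intro borel_measurable_continuous_onI continuous_intros)
  have "(LINT z|circle. z powi j)
      = (LINT x|uniform_measure lborel {0..<2 * pi}. cis x powi j)"
    unfolding circle_def by (rule integral_distr[OF measurable_cis_circle 1])
  also have "uniform_measure lborel {0..<2 * pi}
      = density lborel (\<lambda>x. ennreal (indicator {0..<2 * pi} x / (2 * pi)))"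
    unfolding uniform_measure_def
    by (intro density_cong AE_I2) (auto simp: divide_ennreal[symmetric] indicator_def)
  also have "(LINT x|\<dots>. cis x powi j)
      = (LINT x|lborel. (indicator {0..<2 * pi} x / (2 * pi)) *\<^sub>R (cis x powi j))"
    by (rule integral_density)
      (auto simp: cis_power_int intro!: borel_measurable_continuous_onI continuous_intros)
  also have "\<dots> = (LINT x|lborel. indicator {0..2 * pi} x *\<^sub>R (cis (j * x) / (2 * pi)))"
  proof (rule integral_cong_AE)
    show "AE x in lborel. (indicator {0..<2 * pi} x / (2 * pi)) *\<^sub>R (cis x powi j)
        = indicator {0..2 * pi} x *\<^sub>R (cis (j * x) / (2 * pi))"
      using AE_lborel_singleton[of "2 * pi"]
      by eventually_elim
        (auto simp: indicator_def cis_power_int scaleR_conv_of_real)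
  qed (auto simp: cis_power_int intro!: borel_measurable_scaleR borel_measurable_divide
        borel_measurable_indicator cis_meas)
  also have "\<dots> = F (2 * pi) - F 0"
  proof (rule integral_FTC_Icc)
    fix x :: real
    have "((\<lambda>x. exp (\<i> * (of_int j * of_real x)) / (2 * pi * (\<i> * j))) has_vector_derivative
          (cis (j * x) / (2 * pi))) (at x within {0..2 * pi})"
      using False
      by (auto intro!: derivative_eq_intros has_vector_derivative_real_field
          simp: cis_conv_exp)
    then show "(F has_vector_derivative (cis (j * x) / (2 * pi))) (at x within {0..2 * pi})"
      by (simp add: F_def[abs_def] cis_conv_exp)
  qed (auto intro!: continuous_intros)
  also have "\<dots> = 0"
    using cis_multiple_2pi[of "real_of_int j"] by (simp add: F_def mult.commute mult.left_commute)
  finally show ?thesis using False by simp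
qed

text \<open>A geometric sum whose ratio \<open>\<omega>\<close> satisfies
  \<open>\<omega> ^ M = 1\<close>; the bound on \<open>j\<close> excludes
  \<open>\<omega> = 1\<close> unless \<open>j = 0\<close>.\<close>

lemma sum_cis_roots_of_unity:
  assumes "\<bar>j\<bar> < int M"
  shows "(\<Sum>k<M. cis (of_int j * (2 * pi * real k / real M))) = (if j = 0 then of_nat M else 0)"
proof (cases "j = 0")
  case False
  define \<omega> where "\<omega> = cis (2 * pi * (of_int j / real M))"
  have M: "M > 0" using assms by linarith
  have "\<omega> \<noteq> 1"
  proof
    assume "\<omega> = 1"
    then obtain k :: int where "2 * pi * (of_int j / real M) = of_int k * 2 * pi"
      unfolding \<omega>_def by (auto simp: complex_eq_iff cos_one_2pi_int)
    then have "of_int j = of_int k * real M" using M by (simp add: field_simps)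
    then have "j = k * int M" by (metis of_int_eq_iff of_int_mult of_int_of_nat_eq)
    with assms False show False
      by (metis abs_mult abs_of_nat dvd_triv_right zdvd_imp_le abs_dvd_iff dvd_abs_iff not_le zero_less_abs_iff)
  qed
  have "real M * (2 * pi * (of_int j / real M)) = 2 * pi * of_int j"
    using M by simp
  then have "\<omega> ^ M = cis (2 * pi * of_int j)"
    by (simp only: \<omega>_def Complex.DeMoivre)
  then have "\<omega> ^ M = 1" by simp
  have "(\<Sum>k<M. cis (of_int j * (2 * pi * real k / real M))) = (\<Sum>k<M. \<omega> ^ k)"
    by (intro sum.cong refl) (simp add: \<omega>_def Complex.DeMoivre mult_ac)
  also have "\<dots> = 0"
    using \<open>\<omega> \<noteq> 1\<close> \<open>\<omega> ^ M = 1\<close> by (simp add: geometric_sum)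
  finally show ?thesis using False by simp
qed simp

lemma finite_int_bound:
  assumes "finite (J :: int set)"
  obtains N :: nat where "\<And>j. j \<in> J \<Longrightarrow> \<bar>j\<bar> < int N"
proof -
  have "finite ((\<lambda>j. nat \<bar>j\<bar>) ` J)" using assms by simp
  then obtain N where "\<forall>n\<in>(\<lambda>j. nat \<bar>j\<bar>) ` J. n < N"
    using finite_nat_set_iff_bounded by blast
  then show thesis by (intro that[of N]) auto
qed

text \<open>The \<open>j\<close>-th Fourier coefficient of the Fejer kernel, which is the squared
  modulus of \<open>z ^ 0 + ... + z ^ (n - 1)\<close> divided by \<open>n\<close>. The unevaluated
  double sum is what expanding that square produces, so it matches the weights in
  \<open>fejer_le\<close>.\<close>

definition fejer :: "nat \<Rightarrow> int \<Rightarrow> real" where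
  "fejer n j = (\<Sum>a<n. \<Sum>b<n. of_bool (int a - int b + j = 0)) / real n"

text \<open>For fixed \<open>a\<close> only \<open>b = a + j\<close> contributes, so the double sum
  counts those \<open>a\<close> for which this \<open>b\<close> is in range: an interval of
  \<open>n - \<bar>j\<bar>\<close> integers, or none.\<close>

lemma fejer_eq:
  assumes "n > 0"
  shows "fejer n j = max 0 (1 - \<bar>of_int j\<bar> / real n)"
proof -
  have "(\<Sum>b<n. of_bool (int a - int b + j = 0)) = (of_bool (0 \<le> int a + j \<and> int a + j < int n) :: real)"
    for a
  proof (cases "0 \<le> int a + j \<and> int a + j < int n")
    case True
    have "(int a - int b + j = 0) = (b = nat (int a + j))" for b
      using True by auto
    then show ?thesis using True by (simp add: of_bool_def nat_less_iff)
  next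
    case False
    then show ?thesis by (auto intro!: sum.neutral)
  qed
  then have "fejer n j * n = (\<Sum>a<n. of_bool (0 \<le> int a + j \<and> int a + j < int n))"
    using assms by (simp add: fejer_def)
  also have "\<dots> = real (card {a. a < n \<and> 0 \<le> int a + j \<and> int a + j < int n})"
    by (simp add: sum.If_cases of_bool_def Int_def)
  also have "{a. a < n \<and> 0 \<le> int a + j \<and> int a + j < int n} = {nat (- j)..<nat (min (int n) (int n - j))}"
    by auto
  also have "real (card \<dots>) = max 0 (real n - \<bar>of_int j\<bar>)"
    by (auto simp: min_def max_def of_nat_diff nat_le_iff le_nat_iff)
  finally have "fejer n j = max 0 (real n - \<bar>of_int j\<bar>) / n"
    using assms by (simp add: field_simps)
  then show ?thesis using assms by (auto simp: max_def field_simps)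
qed

section \<open>Monotonicity and the extended norm\<close>

lemma L_infinityI:
  "f \<in> borel_measurable circle \<Longrightarrow> AE z in circle. cmod (f z) \<le> C \<Longrightarrow> f \<in> L_infinity"
  by (auto simp: L_infinity_def)

lemma L_infinityE:
  assumes "f \<in> L_infinity"
  obtains C where "f \<in> borel_measurable circle" "C > 0" "AE z in circle. cmod (f z) \<le> C"
proof -
  from assms obtain C where C: "f \<in> borel_measurable circle" "AE z in circle. cmod (f z) \<le> C"
    by (auto simp: L_infinity_def)
  have "AE z in circle. cmod (f z) \<le> max C 1" using C(2) by eventually_elim auto
  with C(1) show thesis by (intro that[of "max C 1"]) auto
qed

lemma L_infinity_measurable: "f \<in> L_infinity \<Longrightarrow> f \<in> borel_measurable circle"
  by (simp add: L_infinity_def)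

lemma L_infinity_dominated:
  assumes "g \<in> L_infinity" "f \<in> borel_measurable circle" "AE z in circle. cmod (f z) \<le> cmod (g z)"
  shows "f \<in> L_infinity"
proof -
  from assms(1) obtain C where "AE z in circle. cmod (g z) \<le> C" by (auto simp: L_infinity_def)
  with assms(3) have "AE z in circle. cmod (f z) \<le> C" by eventually_elim auto
  with assms(2) show ?thesis by (rule L_infinityI)
qed

lemma L_infinity_const [simp, intro]: "(\<lambda>z. c) \<in> L_infinity"
  by (rule L_infinityI[of _ "cmod c"]) auto

lemma L_infinity_add [intro]:
  assumes "f \<in> L_infinity" "g \<in> L_infinity"
  shows "(\<lambda>z. f z + g z) \<in> L_infinity"
proof -
  obtain C where C: "f \<in> borel_measurable circle" "AE z in circle. cmod (f z) \<le> C"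
    using assms(1) by (rule L_infinityE)
  obtain D where D: "g \<in> borel_measurable circle" "AE z in circle. cmod (g z) \<le> D"
    using assms(2) by (rule L_infinityE)
  have "AE z in circle. cmod (f z + g z) \<le> C + D"
    using C(2) D(2) by eventually_elim (rule norm_triangle_mono)
  with C(1) D(1) show ?thesis by (intro L_infinityI) auto
qed

lemma L_infinity_mult [intro]:
  assumes "f \<in> L_infinity" "g \<in> L_infinity"
  shows "(\<lambda>z. f z * g z) \<in> L_infinity"
proof -
  obtain C where C: "f \<in> borel_measurable circle" "C > 0" "AE z in circle. cmod (f z) \<le> C"
    using assms(1) by (rule L_infinityE)
  obtain D where D: "g \<in> borel_measurable circle" "AE z in circle. cmod (g z) \<le> D"
    using assms(2) by (rule L_infinityE)
  have "AE z in circle. cmod (f z * g z) \<le> C * D"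
    using C(3) D(2) by eventually_elim (use C(2) in \<open>auto simp: norm_mult intro!: mult_mono\<close>)
  with C(1) D(1) show ?thesis by (intro L_infinityI) auto
qed

lemma L_infinity_diff [intro]:
  assumes "f \<in> L_infinity" "g \<in> L_infinity"
  shows "(\<lambda>z. f z - g z) \<in> L_infinity"
  using L_infinity_add[OF assms(1) L_infinity_mult[OF L_infinity_const[of "-1"] assms(2)]] by simp

lemma L_infinity_sum:
  "(\<And>i. i \<in> I \<Longrightarrow> f i \<in> L_infinity) \<Longrightarrow> (\<lambda>z. \<Sum>i\<in>I. f i z) \<in> L_infinity"
  by (induction I rule: infinite_finite_induct) auto

lemma L_infinity_cmod [intro]:
  assumes "f \<in> L_infinity"
  shows "(\<lambda>z. of_real (cmod (f z))) \<in> L_infinity"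
  by (rule L_infinity_dominated[OF assms]) (use assms in \<open>auto dest: L_infinity_measurable\<close>)

lemma L_infinity_indicator [intro]: "E \<in> sets circle \<Longrightarrow> (indicator E :: complex \<Rightarrow> complex) \<in> L_infinity"
  by (rule L_infinityI[of _ 1]) (auto simp: indicator_def)

lemma L_infinity_continuous:
  assumes "continuous_on (sphere 0 1) f"
  shows "f \<in> L_infinity"
proof -
  have "compact (f ` sphere 0 1)" using assms by (intro compact_continuous_image) auto
  then obtain C where "\<forall>z\<in>sphere 0 1. cmod (f z) \<le> C"
    using compact_imp_bounded bounded_iff by (metis imageI)
  then show ?thesis
    using borel_measurable_circle_continuous[OF assms]
    by (intro L_infinityI[of _ C]) (auto simp: space_circle)
qed

lemma L_infinity_simple: "simple_function circle s \<Longrightarrow> s \<in> L_infinity"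
proof -
  assume s: "simple_function circle s"
  then have "bounded (s ` space circle)" by (intro finite_imp_bounded) (simp add: simple_function_def)
  then obtain C where "\<forall>z\<in>space circle. cmod (s z) \<le> C" by (auto simp: bounded_iff)
  with s show ?thesis
    by (intro L_infinityI[of _ C] borel_measurable_simple_function) auto
qed

lemma L_infinity_integrable: "f \<in> L_infinity \<Longrightarrow> integrable circle f"
  by (erule L_infinityE) (rule circle.integrable_const_bound)

section \<open>Consequences of the norm axioms\<close>

locale crs_norm =
  fixes \<alpha> :: "(complex \<Rightarrow> complex) \<Rightarrow> real"
  assumes crs: "continuous_rotationally_symmetric_norm \<alpha>"
begin

lemma
  shows nonneg: "f \<in> L_infinity \<Longrightarrow> 0 \<le> \<alpha> f"
    and eq_0_iff: "f \<in> L_infinity \<Longrightarrow> \<alpha> f = 0 \<longleftrightarrow> (AE z in circle. f z = 0)"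
    and scale: "f \<in> L_infinity \<Longrightarrow> \<alpha> (\<lambda>z. c * f z) = cmod c * \<alpha> f"
    and triangle: "f \<in> L_infinity \<Longrightarrow> g \<in> L_infinity \<Longrightarrow> \<alpha> (\<lambda>z. f z + g z) \<le> \<alpha> f + \<alpha> g"
    and one: "\<alpha> (\<lambda>z. 1) = 1"
    and cmod_eq: "f \<in> L_infinity \<Longrightarrow> \<alpha> (\<lambda>z. of_real (cmod (f z))) = \<alpha> f"
    and rotate: "f \<in> L_infinity \<Longrightarrow> w \<in> sphere 0 1 \<Longrightarrow> \<alpha> (\<lambda>z. f (cnj w * z)) = \<alpha> f"
  using crs unfolding continuous_rotationally_symmetric_norm_def norm_on_L_infinity_def by blast+

lemma const: "\<alpha> (\<lambda>z. c) = cmod c"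
  using scale[OF L_infinity_const[of 1], of c] one by simp

lemma minus_commute:
  assumes "f \<in> L_infinity" "g \<in> L_infinity"
  shows "\<alpha> (\<lambda>z. f z - g z) = \<alpha> (\<lambda>z. g z - f z)"
  using scale[OF L_infinity_diff[OF assms], of "-1"] by simp

lemma sum_le:
  "(\<And>i. i \<in> I \<Longrightarrow> f i \<in> L_infinity) \<Longrightarrow> \<alpha> (\<lambda>z. \<Sum>i\<in>I. f i z) \<le> (\<Sum>i\<in>I. \<alpha> (f i))"
proof (induction I rule: infinite_finite_induct)
  case (insert x F)
  then have "\<alpha> (\<lambda>z. f x z + (\<Sum>i\<in>F. f i z)) \<le> \<alpha> (f x) + \<alpha> (\<lambda>z. \<Sum>i\<in>F. f i z)"
    by (intro triangle L_infinity_sum) auto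
  with insert show ?case by force
qed (auto simp: const)

text \<open>\<open>\<bar>f\<bar>\<close> is the mean of two functions of modulus \<open>\<bar>g\<bar>\<close>, because every \<open>r \<in> [0, 1]\<close> is the
  mean of the two unimodular numbers \<open>r \<plusminus> i \<surd>(1 - r\<^sup>2)\<close>.\<close>

lemma mono:
  assumes g: "g \<in> L_infinity" and f: "f \<in> borel_measurable circle"
    and le: "AE z in circle. cmod (f z) \<le> cmod (g z)"
  shows "\<alpha> f \<le> \<alpha> g"
proof -
  note [measurable] = f L_infinity_measurable[OF g]
  have fL: "f \<in> L_infinity" by (rule L_infinity_dominated[OF g f le])
  \<comment> \<open>The cap at 1 puts \<open>r\<close> into \<open>[0, 1]\<close> at every point and
    not only almost everywhere; where \<open>g z = 0\<close> the quotient is 0 by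
    convention.\<close>
  define r where "r z = min 1 (cmod (f z) / cmod (g z))" for z
  have [measurable]: "r \<in> borel_measurable circle" unfolding r_def by measurable
  have r: "0 \<le> r z" "r z \<le> 1" for z by (auto simp: r_def)
  define u where "u z = of_real (r z) + \<i> * of_real (sqrt (1 - (r z)\<^sup>2))" for z
  have [measurable]: "u \<in> borel_measurable circle" unfolding u_def by measurable
  have u: "cmod (u z) = 1" for z
  proof -
    have "(r z)\<^sup>2 \<le> 1" using r[of z] by (simp add: power_le_one)
    then show ?thesis by (simp add: u_def cmod_def)
  qed
  have cnju [measurable]: "(\<lambda>z. cnj (u z)) \<in> borel_measurable circle"
    by (rule borel_measurable_continuous_onI[THEN measurable_compose_rev]) (auto intro!: continuous_intros)
  have uL: "u \<in> L_infinity" "(\<lambda>z. cnj (u z)) \<in> L_infinity"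
    using u cnju by (auto intro!: L_infinityI[of _ 1])
  define h k where "h z = (1/2) * (g z * u z)" and "k z = (1/2) * (g z * cnj (u z))" for z
  have hk: "h \<in> L_infinity" "k \<in> L_infinity" unfolding h_def k_def by (intro L_infinity_mult L_infinity_const g uL)+
  have unim: "\<alpha> (\<lambda>z. g z * v z) = \<alpha> g" if "v \<in> L_infinity" "\<And>z. cmod (v z) = 1" for v
    using cmod_eq[OF L_infinity_mult[OF g that(1)]] cmod_eq[OF g] by (simp add: norm_mult that(2))
  have half: "\<alpha> h = \<alpha> g / 2" "\<alpha> k = \<alpha> g / 2"
    unfolding h_def k_def using uL g u
    by (simp_all only: scale L_infinity_mult unim complex_mod_cnj) simp_all
  have s: "h z + k z = g z * of_real (r z)" for z
    by (simp add: h_def k_def u_def algebra_simps)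
  have abs_eq: "AE z in circle. cmod (h z + k z) = cmod (f z)"
    using le
  proof eventually_elim
    case (elim z)
    then show ?case
      by (cases "g z = 0") (auto simp: s norm_mult r_def min_def divide_le_eq)
  qed
  have "\<alpha> f = \<alpha> (\<lambda>z. of_real (cmod (f z)))" using cmod_eq[OF fL] by simp
  \<comment> \<open>The moduli of \<open>h + k\<close> and \<open>f\<close> agree only almost
    everywhere, and invariance of \<open>\<alpha>\<close> under such changes is itself derived from
    this lemma in \<open>cong_AE\<close>. So their difference is split off as a null
    function.\<close>
  also have "\<dots> \<le> \<alpha> (\<lambda>z. of_real (cmod (h z + k z)) + (of_real (cmod (f z)) - of_real (cmod (h z + k z))))"
    by simp
  also have "\<dots> \<le> \<alpha> (\<lambda>z. of_real (cmod (h z + k z))) + \<alpha> (\<lambda>z. of_real (cmod (f z)) - of_real (cmod (h z + k z)))"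
    by (intro triangle L_infinity_diff L_infinity_cmod L_infinity_add hk fL)
  also have "\<alpha> (\<lambda>z. of_real (cmod (f z)) - of_real (cmod (h z + k z))) = 0"
    using abs_eq eq_0_iff[OF L_infinity_diff[OF L_infinity_cmod[OF fL] L_infinity_cmod[OF L_infinity_add[OF hk]]]]
    by auto
  also have "\<alpha> (\<lambda>z. of_real (cmod (h z + k z))) = \<alpha> (\<lambda>z. h z + k z)"
    using hk by (intro cmod_eq) auto
  also have "\<dots> \<le> \<alpha> g" using triangle[OF hk] half by simp
  finally show ?thesis by simp
qed

lemma le_bound:
  assumes "f \<in> borel_measurable circle" "AE z in circle. cmod (f z) \<le> C" "0 \<le> C"
  shows "\<alpha> f \<le> C"
  using mono[OF L_infinity_const[of "of_real C"] assms(1)] assms(2,3) const[of "of_real C"] by simp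

lemma cong_AE:
  assumes "f \<in> L_infinity" "g \<in> borel_measurable circle" "AE z in circle. f z = g z"
  shows "\<alpha> f = \<alpha> g"
proof (rule antisym)
  have g: "g \<in> L_infinity"
    by (rule L_infinity_dominated[OF assms(1,2)]) (use assms(3) in eventually_elim, simp)
  show "\<alpha> f \<le> \<alpha> g"
    by (rule mono[OF g L_infinity_measurable[OF assms(1)]]) (use assms(3) in eventually_elim, simp)
  show "\<alpha> g \<le> \<alpha> f"
    by (rule mono[OF assms(1,2)]) (use assms(3) in eventually_elim, simp)
qed

text \<open>Extends the smallness to null sets, whose indicators are null functions and so have
  \<open>\<alpha>\<close> equal to 0. Later estimates produce exceptional sets that may be
  null.\<close>

lemma small_indicator:
  assumes "\<epsilon> > 0"
  obtains \<delta> where "\<delta> > 0"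
    "\<And>E. E \<in> sets circle \<Longrightarrow> measure circle E < \<delta> \<Longrightarrow> \<alpha> (indicator E) < \<epsilon>"
proof -
  from crs assms obtain \<delta> where \<delta>: "\<delta> > 0"
    "\<And>E. E \<in> sets circle \<Longrightarrow> 0 < measure circle E \<Longrightarrow> measure circle E < \<delta> \<Longrightarrow> \<alpha> (indicator E) < \<epsilon>"
    unfolding continuous_rotationally_symmetric_norm_def by blast
  show thesis
  proof (rule that[OF \<delta>(1)])
    fix E assume E: "E \<in> sets circle" "measure circle E < \<delta>"
    show "\<alpha> (indicator E) < \<epsilon>"
    proof (cases "measure circle E = 0")
      case True
      then have "AE z in circle. (indicator E z :: complex) = 0"
        using E(1) by (intro AE_I[where N = E]) (auto simp: circle.emeasure_eq_measure indicator_def)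
      then show ?thesis using eq_0_iff[OF L_infinity_indicator[OF E(1)]] assms by simp
    qed (use E \<delta>(2) in \<open>auto simp: zero_less_measure_iff\<close>)
  qed
qed

end

text \<open>Rounding down to the grid of multiples of \<open>e\<close> leaves a bounded function
  only finitely many values.\<close>

lemma simple_function_floor:
  fixes u :: "'a \<Rightarrow> real"
  assumes [measurable]: "u \<in> borel_measurable M" and C: "\<And>x. x \<in> space M \<Longrightarrow> \<bar>u x\<bar> \<le> C"
  shows "simple_function M (\<lambda>x. e * of_int \<lfloor>u x / e\<rfloor>)"
proof (rule simple_function_borel_measurable)
  \<comment> \<open>The summand 1 absorbs the rounding: a floor may fall below
    \<open>- C / \<bar>e\<bar>\<close> by almost 1.\<close>
  define N where "N = \<lceil>C / \<bar>e\<bar>\<rceil> + 1"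
  have "(\<lambda>x. e * of_int \<lfloor>u x / e\<rfloor>) ` space M \<subseteq> (\<lambda>n. e * of_int n) ` {-N..N}"
  proof safe
    fix x assume "x \<in> space M"
    then have "\<bar>u x / e\<bar> \<le> C / \<bar>e\<bar>" by (simp add: C divide_right_mono)
    then have "\<lfloor>u x / e\<rfloor> \<in> {-N..N}" unfolding N_def by (simp, linarith)
    then show "e * of_int \<lfloor>u x / e\<rfloor> \<in> (\<lambda>n. e * of_int n) ` {-N..N}" by blast
  qed
  then show "finite ((\<lambda>x. e * of_int \<lfloor>u x / e\<rfloor>) ` space M)"
    by (rule finite_subset) auto
qed measurable

lemma floor_approx:
  fixes x e :: real
  assumes "e > 0"
  shows "e * of_int \<lfloor>x / e\<rfloor> \<le> x" "x \<le> e * of_int \<lfloor>x / e\<rfloor> + e"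
proof -
  have "of_int \<lfloor>x / e\<rfloor> \<le> x / e" "x / e \<le> of_int \<lfloor>x / e\<rfloor> + 1" by linarith+
  then show "e * of_int \<lfloor>x / e\<rfloor> \<le> x" "x \<le> e * of_int \<lfloor>x / e\<rfloor> + e"
    using assms by (simp_all only: pos_le_divide_eq pos_divide_le_eq) (simp_all add: algebra_simps)
qed

text \<open>Real and imaginary part are rounded separately on a grid of mesh \<open>e / 2\<close>;
  the modulus is at most the sum of the two errors.\<close>

lemma L_infinity_approx_simple:
  assumes "f \<in> L_infinity" "e > 0"
  obtains s where "simple_function circle s" "AE z in circle. cmod (f z - s z) \<le> e"
proof -
  obtain C where C: "f \<in> borel_measurable circle" "C > 0" "AE z in circle. cmod (f z) \<le> C"
    using assms(1) by (rule L_infinityE)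
  note [measurable] = C(1)
  \<comment> \<open>Truncation turns the almost everywhere bound into one at every point, which
    \<open>simple_function_floor\<close> requires.\<close>
  define g where "g z = (if cmod (f z) \<le> C then f z else 0)" for z
  have [measurable]: "g \<in> borel_measurable circle" unfolding g_def by measurable
  have g: "cmod (g z) \<le> C" for z using C(2) by (simp add: g_def)
  have b: "\<bar>Re (g z)\<bar> \<le> C" "\<bar>Im (g z)\<bar> \<le> C" for z
    using g[of z] abs_Re_le_cmod[of "g z"] abs_Im_le_cmod[of "g z"] by linarith+
  define d where "d = e / 2"
  have d: "d > 0" using assms(2) by (simp add: d_def)
  define s where "s z = Complex (d * of_int \<lfloor>Re (g z) / d\<rfloor>) (d * of_int \<lfloor>Im (g z) / d\<rfloor>)" for z
  have s: "simple_function circle s" unfolding s_def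
    by (intro simple_function_compose2[of _ _ _ Complex] simple_function_floor[of _ _ C]) (auto simp: b)
  have "cmod (g z - s z) \<le> e" for z
  proof -
    have "\<bar>Re (g z - s z)\<bar> \<le> d" "\<bar>Im (g z - s z)\<bar> \<le> d"
      using floor_approx[OF d, of "Re (g z)"] floor_approx[OF d, of "Im (g z)"]
      by (simp_all add: s_def abs_le_iff)
    then show ?thesis using cmod_le[of "g z - s z"] by (simp add: d_def)
  qed
  note gs = this
  have "AE z in circle. cmod (f z - s z) \<le> e"
    using C(3)
  proof eventually_elim
    case (elim z)
    then show ?case using gs[of z] by (simp add: g_def)
  qed
  with s show thesis by (rule that)
qed

section \<open>The extended norm on measurable functions\<close>

context crs_norm
begin

text \<open>Lets any bounded \<open>u\<close> compete in the supremum that defines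
  \<open>extended_norm\<close>. Since \<open>\<alpha>\<close> sees only moduli, it suffices to round
  \<open>\<bar>u\<bar>\<close> down to multiples of \<open>e\<close>: the result is simple, stays
  below \<open>\<bar>f\<bar>\<close> and loses at most \<open>e\<close>.\<close>

lemma le_extended_norm:
  assumes u: "u \<in> L_infinity" and le: "AE z in circle. cmod (u z) \<le> cmod (f z)"
  shows "ennreal (\<alpha> u) \<le> extended_norm \<alpha> f"
proof (rule ennreal_le_epsilon)
  fix e :: real assume e: "e > 0"
  obtain C where C: "u \<in> borel_measurable circle" "C > 0" "AE z in circle. cmod (u z) \<le> C"
    using u by (rule L_infinityE)
  note [measurable] = C(1)
  define r where "r z = e * of_int \<lfloor>min (cmod (u z)) C / e\<rfloor>" for z
  define s where "s z = complex_of_real (r z)" for z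
  have r: "0 \<le> r z" "r z \<le> min (cmod (u z)) C" "min (cmod (u z)) C \<le> r z + e" for z
    using floor_approx[OF e, of "min (cmod (u z)) C"] e C(2) by (auto simp: r_def)
  have "simple_function circle r" unfolding r_def
  proof (rule simple_function_floor)
    show "\<bar>min (cmod (u x)) C\<bar> \<le> C" for x
      using C(2) norm_ge_zero[of "u x"] by linarith
  qed simp
  then have s: "simple_function circle s"
    unfolding s_def by (rule simple_function_compose1)
  have "AE z in circle. cmod (s z) \<le> cmod (f z)"
    using le
  proof eventually_elim
    case (elim z)
    then show ?case using r(1,2)[of z] by (simp add: s_def)
  qed
  with s have "ennreal (\<alpha> s) \<le> extended_norm \<alpha> f"
    unfolding extended_norm_def by (intro SUP_upper) auto
  moreover
  have "\<alpha> u \<le> \<alpha> s + e"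
  proof -
    have sL: "s \<in> L_infinity" using s by (rule L_infinity_simple)
    have "\<alpha> u = \<alpha> (\<lambda>z. s z + (of_real (cmod (u z)) - s z))" using cmod_eq[OF u] by simp
    also have "\<dots> \<le> \<alpha> s + \<alpha> (\<lambda>z. of_real (cmod (u z)) - s z)"
      by (intro triangle L_infinity_diff L_infinity_cmod u sL)
    also have "\<alpha> (\<lambda>z. of_real (cmod (u z)) - s z) \<le> e"
    proof (rule le_bound)
      show "AE z in circle. cmod (of_real (cmod (u z)) - s z) \<le> e"
        using C(3)
      proof eventually_elim
        case (elim z)
        have eq: "of_real (cmod (u z)) - s z = of_real (cmod (u z) - r z)"
          by (simp add: s_def)
        from elim show ?case using r[of z]
          unfolding eq norm_of_real by (simp add: min_absorb1)
      qed
    qed (use L_infinity_measurable[OF sL] e in auto)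
    finally show ?thesis by simp
  qed
  then have "ennreal (\<alpha> u) \<le> ennreal (\<alpha> s) + ennreal e"
    using nonneg[OF L_infinity_simple[OF s]] e by (simp flip: ennreal_plus)
  ultimately show "ennreal (\<alpha> u) \<le> extended_norm \<alpha> f + ennreal e"
    by (blast intro: order_trans add_right_mono)
qed

lemma extended_norm_eq:
  assumes "f \<in> L_infinity"
  shows "extended_norm \<alpha> f = ennreal (\<alpha> f)"
proof (rule antisym)
  show "extended_norm \<alpha> f \<le> ennreal (\<alpha> f)"
    unfolding extended_norm_def
    by (auto intro!: SUP_least ennreal_leI mono[OF assms] borel_measurable_simple_function)
qed (use assms in \<open>auto intro!: le_extended_norm\<close>)

text \<open>A simple \<open>s\<close> below \<open>f + g\<close> is divided, up to modulus, into
  \<open>u\<close> below \<open>f\<close> and \<open>v\<close> below \<open>g\<close>. These parts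
  are bounded but need not be simple, which is where \<open>le_extended_norm\<close> enters.\<close>

lemma extended_norm_triangle:
  assumes [measurable]: "f \<in> borel_measurable circle" "g \<in> borel_measurable circle"
  shows "extended_norm \<alpha> (\<lambda>z. f z + g z) \<le> extended_norm \<alpha> f + extended_norm \<alpha> g"
  unfolding extended_norm_def[of _ "\<lambda>z. f z + g z"]
proof (rule SUP_least, safe)
  fix s assume s: "simple_function circle s" and le: "AE z in circle. cmod (s z) \<le> cmod (f z + g z)"
  have sL: "s \<in> L_infinity" using s by (rule L_infinity_simple)
  note [measurable] = L_infinity_measurable[OF sL]
  \<comment> \<open>\<open>u\<close> takes as much of \<open>\<bar>s\<bar>\<close> as
    \<open>\<bar>f\<bar>\<close> allows; the rest is 0 or at most
    \<open>\<bar>f + g\<bar> - \<bar>f\<bar> \<le> \<bar>g\<bar>\<close>.\<close>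
  define u v where "u z = complex_of_real (min (cmod (s z)) (cmod (f z)))"
    and "v z = complex_of_real (cmod (s z) - min (cmod (s z)) (cmod (f z)))" for z
  have [measurable]: "u \<in> borel_measurable circle" "v \<in> borel_measurable circle"
    unfolding u_def v_def by measurable
  have uv: "u \<in> L_infinity" "v \<in> L_infinity"
    by (rule L_infinity_dominated[OF sL]; simp add: u_def v_def min_def del: of_real_diff)+
  have "AE z in circle. cmod (v z) \<le> cmod (g z)" using le
  proof eventually_elim
    case (elim z)
    then show ?case using norm_triangle_ineq[of "f z" "g z"]
      by (auto simp: v_def min_def simp del: of_real_diff)
  qed
  then have v: "ennreal (\<alpha> v) \<le> extended_norm \<alpha> g" by (rule le_extended_norm[OF uv(2)])
  have u: "ennreal (\<alpha> u) \<le> extended_norm \<alpha> f"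
    by (rule le_extended_norm[OF uv(1)]) (simp add: u_def)
  have "\<alpha> s = \<alpha> (\<lambda>z. u z + v z)" using cmod_eq[OF sL] by (simp add: u_def v_def)
  also have "\<dots> \<le> \<alpha> u + \<alpha> v" using uv by (rule triangle)
  finally have "ennreal (\<alpha> s) \<le> ennreal (\<alpha> u) + ennreal (\<alpha> v)"
    using uv by (simp add: nonneg flip: ennreal_plus)
  also have "\<dots> \<le> extended_norm \<alpha> f + extended_norm \<alpha> g" using u v by (rule add_mono)
  finally show "ennreal (\<alpha> s) \<le> \<dots>" .
qed

end

lemma extended_norm_minus_commute:
  "extended_norm \<alpha> (\<lambda>z. f z - g z) = extended_norm \<alpha> (\<lambda>z. g z - f z)"
  by (simp add: extended_norm_def norm_minus_commute)

section \<open>Density of trigonometric polynomials\<close>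

text \<open>Frequencies and coefficients are kept apart so that Fourier multipliers act on
  \<open>c\<close> alone. An infinite \<open>J\<close> gives the zero function, so
  \<open>trig J c\<close> is continuous on the circle for every \<open>J\<close>.\<close>

definition trig :: "int set \<Rightarrow> (int \<Rightarrow> complex) \<Rightarrow> complex \<Rightarrow> complex" where
  "trig J c z = (\<Sum>j\<in>J. c j * z powi j)"

lemma trig_L_infinity [intro]: "trig J c \<in> L_infinity"
  unfolding trig_def by (intro L_infinity_continuous continuous_intros sphere_nonzero) auto

lemma trig_extend:
  assumes "finite K" "J \<subseteq> K"
  shows "trig J c z = trig K (\<lambda>j. if j \<in> J then c j else 0) z"
  unfolding trig_def using assms by (intro sum.mono_neutral_cong_left) auto

text \<open>Clearing negative exponents by \<open>z ^ N\<close> turns sums and products of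
  trigonometric polynomials into those of ordinary ones, so the closure properties are those of
  \<open>poly\<close>. The equation is asked for only on the circle, where \<open>cnj z\<close> is
  \<open>1 / z\<close>.\<close>

definition laurent_on_circle :: "(complex \<Rightarrow> complex) \<Rightarrow> bool" where
  "laurent_on_circle f \<longleftrightarrow> (\<exists>N p. \<forall>z\<in>sphere 0 1. z ^ N * f z = poly p z)"

lemma laurent_on_circle_const: "laurent_on_circle (\<lambda>z. c)"
  unfolding laurent_on_circle_def by (rule exI[of _ 0], rule exI[of _ "[:c:]"]) simp

lemma laurent_on_circle_add:
  assumes "laurent_on_circle f" "laurent_on_circle g"
  shows "laurent_on_circle (\<lambda>z. f z + g z)"
proof -
  from assms obtain M p N q where "\<forall>z\<in>sphere 0 1. z ^ M * f z = poly p z"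
    "\<forall>z\<in>sphere 0 1. z ^ N * g z = poly q z"
    unfolding laurent_on_circle_def by blast
  moreover have "z ^ (M + N) * (f z + g z) = z ^ N * (z ^ M * f z) + z ^ M * (z ^ N * g z)" for z
    by (simp add: power_add algebra_simps)
  ultimately have "z ^ (M + N) * (f z + g z) = poly (monom 1 N * p + monom 1 M * q) z"
    if "z \<in> sphere 0 1" for z
    using that by (simp add: poly_monom)
  then show ?thesis unfolding laurent_on_circle_def by blast
qed

lemma laurent_on_circle_mult:
  assumes "laurent_on_circle f" "laurent_on_circle g"
  shows "laurent_on_circle (\<lambda>z. f z * g z)"
proof -
  from assms obtain M p N q where "\<forall>z\<in>sphere 0 1. z ^ M * f z = poly p z"
    "\<forall>z\<in>sphere 0 1. z ^ N * g z = poly q z"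
    unfolding laurent_on_circle_def by blast
  moreover have "z ^ (M + N) * (f z * g z) = (z ^ M * f z) * (z ^ N * g z)" for z
    by (simp add: power_add mult_ac)
  ultimately have "z ^ (M + N) * (f z * g z) = poly (p * q) z" if "z \<in> sphere 0 1" for z
    using that by (metis poly_mult)
  then show ?thesis unfolding laurent_on_circle_def by blast
qed

text \<open>A real linear form is \<open>a * z + cnj a * cnj z\<close>, and multiplication by
  \<open>z\<close> turns \<open>cnj z\<close> into 1 on the circle.\<close>

lemma laurent_on_circle_linear:
  assumes "bounded_linear (f :: complex \<Rightarrow> real)"
  shows "laurent_on_circle (\<lambda>z. of_real (f z))"
proof -
  interpret bounded_linear f by fact
  \<comment> \<open>The choice for which twice the real part of \<open>a * z\<close> equals
    \<open>f 1\<close> at \<open>z = 1\<close> and \<open>f \<i>\<close> at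
    \<open>z = \<i>\<close>.\<close>
  define a where "a = Complex (f 1) (- f \<i>) / 2"
  have *: "of_real (f z) = a * z + cnj a * cnj z" for z
  proof -
    have "f z = f (Re z *\<^sub>R 1 + Im z *\<^sub>R \<i>)"
      by (rule arg_cong[of _ _ f]) (simp add: complex_eq_iff)
    also have "\<dots> = Re z * f 1 + Im z * f \<i>" by (simp only: add scaleR real_scaleR_def)
    finally show ?thesis by (simp add: a_def complex_eq_iff field_simps)
  qed
  have "z ^ 1 * of_real (f z) = poly [:cnj a, 0, a:] z" if "z \<in> sphere 0 1" for z
  proof -
    have "z * cnj z = 1" using that by (simp add: complex_norm_square[symmetric])
    then have "z * (a * z + cnj a * cnj z) = a * z * z + cnj a" by algebra
    then show ?thesis by (simp add: * algebra_simps)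
  qed
  then show ?thesis unfolding laurent_on_circle_def by blast
qed

lemma laurent_on_circle_real_polynomial:
  "real_polynomial_function f \<Longrightarrow> laurent_on_circle (\<lambda>z. of_real (f z))"
  by (induction rule: real_polynomial_function.induct)
    (simp_all add: laurent_on_circle_const laurent_on_circle_add laurent_on_circle_mult
      laurent_on_circle_linear)

lemma laurent_on_circle_polynomial_function:
  assumes "polynomial_function g"
  shows "laurent_on_circle g"
proof -
  have "real_polynomial_function (\<lambda>z. Re (g z))" "real_polynomial_function (\<lambda>z. Im (g z))"
    using assms bounded_linear_Re bounded_linear_Im
    by (auto simp: polynomial_function_def o_def)
  then have "laurent_on_circle (\<lambda>z. of_real (Re (g z)) + \<i> * of_real (Im (g z)))"
    by (intro laurent_on_circle_add laurent_on_circle_mult laurent_on_circle_const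
        laurent_on_circle_real_polynomial)
  then show ?thesis by (simp flip: complex_eq)
qed

lemma laurent_on_circle_trig:
  assumes "laurent_on_circle f"
  obtains J c where "finite J" "\<And>z. z \<in> sphere 0 1 \<Longrightarrow> f z = trig J c z"
proof -
  from assms obtain N p where p: "\<And>z. z \<in> sphere 0 1 \<Longrightarrow> z ^ N * f z = poly p z"
    unfolding laurent_on_circle_def by blast
  define J where "J = (\<lambda>i. int i - int N) ` {..degree p}"
  define c where "c j = coeff p (nat (j + int N))" for j
  show thesis
  proof (rule that)
    show "finite J" by (simp add: J_def)
    fix z :: complex assume z: "z \<in> sphere 0 1"
    have "z ^ N * trig J c z = (\<Sum>i\<le>degree p. coeff p i * (z ^ N * z powi (int i - int N)))"
      unfolding trig_def J_def
      by (subst sum.reindex) (auto simp: inj_on_def c_def sum_distrib_left mult_ac)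
    also have "\<dots> = poly p z"
      using sphere_nonzero[OF z]
      by (auto simp: poly_altdef power_int_diff intro!: sum.cong)
    also have "\<dots> = z ^ N * f z" using p[OF z] by simp
    finally show "f z = trig J c z" using sphere_nonzero[OF z] by simp
  qed
qed

text \<open>Stone-Weierstrass yields a polynomial in the real and imaginary parts, and on the circle
  each of these is a trigonometric polynomial.\<close>

lemma trig_dense_continuous:
  assumes "continuous_on (sphere 0 1) f" "e > 0"
  obtains J c where "finite J" "\<And>z. z \<in> sphere 0 1 \<Longrightarrow> cmod (f z - trig J c z) < e"
proof -
  obtain g where g: "polynomial_function g" "\<And>z. z \<in> sphere 0 1 \<Longrightarrow> cmod (f z - g z) < e"
    using Stone_Weierstrass_polynomial_function[OF _ assms] by auto
  obtain J c where "finite J" "\<And>z. z \<in> sphere 0 1 \<Longrightarrow> g z = trig J c z"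
    using laurent_on_circle_trig[OF laurent_on_circle_polynomial_function[OF g(1)]] by metis
  with g(2) show thesis by (intro that[of J c]) auto
qed

section \<open>Approximation of bounded functions\<close>

context crs_norm
begin

text \<open>\<open>\<beta>\<close> controls \<open>\<alpha>\<close> and the \<open>L\<^sup>1\<close> norm simultaneously, so that one approximation argument
  serves both.\<close>

definition \<beta> :: "(complex \<Rightarrow> complex) \<Rightarrow> real" where
  "\<beta> f = \<alpha> f + (LINT z|circle. cmod (f z))"

lemma \<beta>_mono:
  assumes "g \<in> L_infinity" "f \<in> borel_measurable circle" "AE z in circle. cmod (f z) \<le> cmod (g z)"
  shows "\<beta> f \<le> \<beta> g"
proof -
  have "f \<in> L_infinity" by (rule L_infinity_dominated[OF assms])
  then show ?thesis unfolding \<beta>_def using assms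
    by (intro add_mono mono integral_mono_AE integrable_norm L_infinity_integrable) auto
qed

lemma \<beta>_le_bound:
  assumes "f \<in> borel_measurable circle" "AE z in circle. cmod (f z) \<le> C" "0 \<le> C"
  shows "\<beta> f \<le> 2 * C"
proof -
  have "\<beta> f \<le> \<beta> (\<lambda>z. of_real C)" using assms by (intro \<beta>_mono) auto
  also have "\<dots> = 2 * C" using assms(3) by (simp add: \<beta>_def const)
  finally show ?thesis .
qed

lemma \<beta>_triangle:
  assumes "f \<in> L_infinity" "g \<in> L_infinity"
  shows "\<beta> (\<lambda>z. f z + g z) \<le> \<beta> f + \<beta> g"
proof -
  have "(LINT z|circle. cmod (f z + g z)) \<le> (LINT z|circle. cmod (f z) + cmod (g z))"
    using assms
    by (intro integral_mono integrable_norm Bochner_Integration.integrable_add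
        L_infinity_integrable norm_triangle_ineq) auto
  also have "\<dots> = (LINT z|circle. cmod (f z)) + (LINT z|circle. cmod (g z))"
    using assms by (intro Bochner_Integration.integral_add integrable_norm L_infinity_integrable)
  finally show ?thesis using triangle[OF assms] by (simp add: \<beta>_def)
qed

lemma \<beta>_triangle_diff:
  assumes "f \<in> L_infinity" "g \<in> L_infinity" "h \<in> L_infinity"
  shows "\<beta> (\<lambda>z. f z - h z) \<le> \<beta> (\<lambda>z. f z - g z) + \<beta> (\<lambda>z. g z - h z)"
  using \<beta>_triangle[OF L_infinity_diff[OF assms(1,2)] L_infinity_diff[OF assms(2,3)]] by simp

lemma \<beta>_scale: "f \<in> L_infinity \<Longrightarrow> \<beta> (\<lambda>z. c * f z) = cmod c * \<beta> f"
  by (simp add: \<beta>_def scale norm_mult distrib_left)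

definition approximable :: "(complex \<Rightarrow> complex) \<Rightarrow> bool" where
  "approximable f \<longleftrightarrow> f \<in> L_infinity \<and> (\<forall>e>0. \<exists>J c. finite J \<and> \<beta> (\<lambda>z. f z - trig J c z) < e)"

lemma approximable_closed:
  assumes f: "f \<in> L_infinity"
    and app: "\<And>e. e > 0 \<Longrightarrow> \<exists>g. approximable g \<and> \<beta> (\<lambda>z. f z - g z) \<le> e"
  shows "approximable f"
  unfolding approximable_def
proof (intro conjI allI impI f)
  fix e :: real assume e: "e > 0"
  then obtain g where g: "approximable g" "\<beta> (\<lambda>z. f z - g z) \<le> e / 2"
    using app[of "e / 2"] by auto
  then obtain J c where J: "finite J" "\<beta> (\<lambda>z. g z - trig J c z) < e / 2"
    using e unfolding approximable_def by (meson half_gt_zero)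
  have "\<beta> (\<lambda>z. f z - trig J c z) < e"
    using \<beta>_triangle_diff[OF f _ trig_L_infinity, of g J c] g J(2) by (auto simp: approximable_def)
  with J(1) show "\<exists>J c. finite J \<and> \<beta> (\<lambda>z. f z - trig J c z) < e" by blast
qed

lemma approximable_continuous:
  assumes "continuous_on (sphere 0 1) f"
  shows "approximable f"
  unfolding approximable_def
proof (intro conjI allI impI)
  show f: "f \<in> L_infinity" using assms by (rule L_infinity_continuous)
  fix e :: real assume e: "e > 0"
  then obtain J c where J: "finite J" "\<And>z. z \<in> sphere 0 1 \<Longrightarrow> cmod (f z - trig J c z) < e / 4"
    using trig_dense_continuous[OF assms, of "e / 4"] by auto
  have "\<beta> (\<lambda>z. f z - trig J c z) \<le> 2 * (e / 4)"
    using J(2) e f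
    by (intro \<beta>_le_bound L_infinity_measurable L_infinity_diff trig_L_infinity)
       (auto simp: space_circle intro!: AE_I2 less_imp_le)
  with e have "\<beta> (\<lambda>z. f z - trig J c z) < e" by linarith
  with J(1) show "\<exists>J c. finite J \<and> \<beta> (\<lambda>z. f z - trig J c z) < e" by blast
qed

lemma approximable_add_scale:
  assumes "approximable f" "approximable g"
  shows "approximable (\<lambda>z. a * f z + g z)"
  unfolding approximable_def
proof (intro conjI allI impI)
  have L: "f \<in> L_infinity" "g \<in> L_infinity" using assms by (auto simp: approximable_def)
  show "(\<lambda>z. a * f z + g z) \<in> L_infinity" by (intro L_infinity_add L_infinity_mult L_infinity_const L)
  fix e :: real assume e: "e > 0"
  define d where "d = e / (2 * (cmod a + 1))"
  have d: "d > 0" using e by (simp add: d_def add_nonneg_pos)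
  obtain J c where J: "finite J" "\<beta> (\<lambda>z. f z - trig J c z) < d"
    using assms(1) d unfolding approximable_def by blast
  obtain K b where K: "finite K" "\<beta> (\<lambda>z. g z - trig K b z) < e / 2"
    using assms(2) e unfolding approximable_def by (meson half_gt_zero)
  define c' where "c' j = a * (if j \<in> J then c j else 0) + (if j \<in> K then b j else 0)" for j
  have c': "trig (J \<union> K) c' z = a * trig J c z + trig K b z" for z
    using trig_extend[of "J \<union> K" J c z] trig_extend[of "J \<union> K" K b z] J(1) K(1)
    by (simp only: trig_def[of "J \<union> K"] c'_def sum_distrib_left distrib_right sum.distrib mult.assoc
        finite_Un Un_upper1 Un_upper2 simp_thms)
  have "\<beta> (\<lambda>z. a * f z + g z - trig (J \<union> K) c' z)
      = \<beta> (\<lambda>z. a * (f z - trig J c z) + (g z - trig K b z))"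
    by (simp add: c' algebra_simps)
  also have "\<dots> \<le> \<beta> (\<lambda>z. a * (f z - trig J c z)) + \<beta> (\<lambda>z. g z - trig K b z)"
    by (intro \<beta>_triangle L_infinity_mult L_infinity_const L_infinity_diff L trig_L_infinity)
  also have "\<beta> (\<lambda>z. a * (f z - trig J c z)) = cmod a * \<beta> (\<lambda>z. f z - trig J c z)"
    by (intro \<beta>_scale L_infinity_diff L trig_L_infinity)
  also have "\<dots> \<le> (cmod a + 1) * d"
    using J(2) d by (intro mult_mono') (auto simp: \<beta>_def intro!: add_nonneg_nonneg nonneg L_infinity_diff L)
  also have "\<dots> = e / 2" using add_nonneg_pos[of "cmod a" 1] by (simp add: d_def divide_simps)
  finally have "\<beta> (\<lambda>z. a * f z + g z - trig (J \<union> K) c' z) < e" using K(2) by simp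
  with J(1) K(1) show "\<exists>J c. finite J \<and> \<beta> (\<lambda>z. a * f z + g z - trig J c z) < e" by blast
qed

lemma approximable_sum:
  assumes "finite I" "\<And>i. i \<in> I \<Longrightarrow> approximable (f i)"
  shows "approximable (\<lambda>z. \<Sum>i\<in>I. a i * f i z)"
  using assms
  by (induction I) (auto intro: approximable_add_scale approximable_continuous)

text \<open>\<open>\<alpha>\<close> of the indicator is small by the continuity of the norm, and its
  \<open>L\<^sup>1\<close> norm is the measure of \<open>E\<close>.\<close>

lemma \<beta>_small_indicator:
  assumes "e > 0"
  obtains \<delta> where "\<delta> > 0" "\<And>E. E \<in> sets circle \<Longrightarrow> measure circle E < \<delta> \<Longrightarrow> \<beta> (indicator E) < e"
proof -
  obtain \<delta> where \<delta>: "\<delta> > 0"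
    "\<And>E. E \<in> sets circle \<Longrightarrow> measure circle E < \<delta> \<Longrightarrow> \<alpha> (indicator E) < e / 2"
    using small_indicator[of "e / 2"] assms by auto
  show thesis
  proof (rule that[of "min \<delta> (e / 2)"])
    fix E assume E: "E \<in> sets circle" "measure circle E < min \<delta> (e / 2)"
    have "(LINT z|circle. cmod (indicator E z)) = (LINT z|circle. indicator E z :: real)"
      by (intro Bochner_Integration.integral_cong) (auto simp: indicator_def)
    also have "\<dots> = measure circle E" using E(1) sets.sets_into_space by simp
    finally show "\<beta> (indicator E) < e" using \<delta>(2)[OF E(1)] E(2) by (simp add: \<beta>_def)
  qed (use \<delta> assms in auto)
qed

text \<open>Inner and outer regularity concern measures on the Borel sets of the plane, so they are
  applied to the image \<open>M\<close> of \<open>circle\<close> under inclusion, which gives a set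
  the measure of its trace on the circle.\<close>

lemma circle_regular:
  assumes E: "E \<in> sets circle" and "\<delta> > 0"
  obtains K U where "compact K" "open U" "K \<subseteq> E" "E \<subseteq> U" "measure circle ((U - K) \<inter> sphere 0 1) < \<delta>"
proof -
  define M where "M = distr circle borel (\<lambda>z. z)"
  have id: "(\<lambda>z. z) \<in> measurable circle borel"
    by (rule borel_measurable_circle_continuous) (rule continuous_on_id)
  have M: "sets M = sets borel" by (simp add: M_def)
  interpret M: finite_measure M unfolding M_def by (rule circle.finite_measure_distr[OF id])
  have eM: "measure M A = measure circle (A \<inter> sphere 0 1)" if "A \<in> sets borel" for A
    unfolding M_def using measure_distr[OF id that] by (simp add: space_circle)
  have EB: "E \<in> sets borel"
    using E by (auto simp: sets_circle sets_restrict_space_iff)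
  have fin: "emeasure M (space M) \<noteq> \<infinity>" by simp
  have "emeasure M E < emeasure M E + ennreal (\<delta> / 2)"
    using \<open>\<delta> > 0\<close>
    by (simp add: M.emeasure_eq_measure ennreal_less_iff flip: ennreal_plus)
  then obtain U where U: "E \<subseteq> U" "open U" "emeasure M U < emeasure M E + ennreal (\<delta> / 2)"
    using outer_regular[OF M fin EB] by (auto simp: INF_less_iff)
  \<comment> \<open>If \<open>E\<close> has measure below \<open>\<delta> / 2\<close>, the empty set
    serves as \<open>K\<close>; otherwise the difference is nonnegative and \<open>ennreal\<close>
    does not truncate it.\<close>
  have "\<exists>K. K \<subseteq> E \<and> compact K \<and> measure M E - \<delta> / 2 < measure M K"
  proof (cases "measure M E < \<delta> / 2")
    case True
    then show ?thesis by (intro exI[of _ "{}"]) auto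
  next
    case False
    then have "ennreal (measure M E - \<delta> / 2) < emeasure M E"
      using \<open>\<delta> > 0\<close> by (simp add: M.emeasure_eq_measure ennreal_less_iff)
    then obtain K where "K \<subseteq> E" "compact K" "ennreal (measure M E - \<delta> / 2) < emeasure M K"
      using inner_regular[OF M fin EB] by (auto simp: less_SUP_iff)
    with False show ?thesis by (auto simp: M.emeasure_eq_measure ennreal_less_iff)
  qed
  then obtain K where K: "K \<subseteq> E" "compact K" "measure M E - \<delta> / 2 < measure M K" by blast
  have UKB: "U \<in> sets borel" "K \<in> sets borel" using U K by (auto intro: borel_open borel_compact)
  have "measure M U < measure M E + \<delta> / 2"
    using U(3) \<open>\<delta> > 0\<close> by (simp add: M.emeasure_eq_measure ennreal_less_iff flip: ennreal_plus)
  moreover have "measure M (U - K) = measure M U - measure M K"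
    using UKB U(1) K(1) M by (intro M.finite_measure_Diff) auto
  ultimately have "measure M (U - K) < \<delta>" using K(3) by linarith
  then have "measure circle ((U - K) \<inter> sphere 0 1) < \<delta>" using eM[of "U - K"] UKB by auto
  then show thesis using that U K by blast
qed

text \<open>A Urysohn function for \<open>K\<close> and \<open>U\<close> differs from the indicator
  only on \<open>U - K\<close>, and there by at most 1. The trace of that set on the circle has
  small measure, so continuity of the norm makes the error small in \<open>\<beta>\<close>.\<close>

lemma approximable_indicator:
  assumes E: "E \<in> sets circle"
  shows "approximable (indicator E)"
proof (rule approximable_closed)
  show EL: "(indicator E :: complex \<Rightarrow> complex) \<in> L_infinity" using E by (rule L_infinity_indicator)
  fix e :: real assume "e > 0"
  then obtain \<delta> where \<delta>: "\<delta> > 0"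
    "\<And>E. E \<in> sets circle \<Longrightarrow> measure circle E < \<delta> \<Longrightarrow> \<beta> (indicator E) < e"
    using \<beta>_small_indicator by blast
  obtain K U where KU: "compact K" "open U" "K \<subseteq> E" "E \<subseteq> U"
    "measure circle ((U - K) \<inter> sphere 0 1) < \<delta>"
    using circle_regular[OF E \<delta>(1)] .
  obtain g :: "complex \<Rightarrow> complex" where g: "continuous_on UNIV g"
    "\<And>x. g x \<in> closed_segment 1 0" "\<And>x. x \<in> K \<Longrightarrow> g x = 1" "\<And>x. x \<in> - U \<Longrightarrow> g x = 0"
  proof (rule Urysohn[of K "- U" "1 :: complex" 0])
    show "closed K" "closed (- U)" "K \<inter> - U = {}"
      using KU compact_imp_closed by auto
  qed (rule that)
  have gL: "g \<in> L_infinity" using g(1) by (intro L_infinity_continuous) (rule continuous_on_subset, auto)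
  have g1: "\<exists>t. 0 \<le> t \<and> t \<le> 1 \<and> g x = of_real t" for x
  proof -
    obtain t where "0 \<le> t" "t \<le> 1" "g x = (1 - t) *\<^sub>R 1 + t *\<^sub>R 0"
      using g(2)[of x] unfolding in_segment by blast
    then show ?thesis by (intro exI[of _ "1 - t"]) (simp add: scaleR_conv_of_real)
  qed
  let ?D = "(U - K) \<inter> sphere 0 1"
  have D: "?D \<in> sets circle"
  proof -
    have "U - K \<in> sets borel" using KU(1,2) by (intro sets.Diff borel_open borel_compact)
    then show ?thesis by (auto simp: sets_circle sets_restrict_space_iff)
  qed
  have "\<beta> (\<lambda>z. indicator E z - g z) \<le> \<beta> (indicator ?D)"
  proof (rule \<beta>_mono)
    show "AE z in circle. cmod (indicator E z - g z) \<le> cmod (indicator ?D z)"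
    proof (rule AE_I2)
      fix z assume z: "z \<in> space circle"
      obtain t where t: "0 \<le> t" "t \<le> 1" "g z = of_real t" using g1 by blast
      have "cmod (indicator E z - g z) \<le> 1"
      proof (cases "z \<in> E")
        case True
        then have eq: "indicator E z - g z = of_real (1 - t)" using t by simp
        show ?thesis unfolding eq norm_of_real using t by simp
      qed (use t in simp)
      then show "cmod (indicator E z - g z) \<le> cmod (indicator ?D z)"
        using z g(3,4)[of z] KU(3,4) by (cases "z \<in> K"; cases "z \<in> U") (auto simp: indicator_def space_circle)
    qed
  qed (use EL gL D in \<open>auto intro!: borel_measurable_diff L_infinity_measurable\<close>)
  also have "\<dots> < e" by (rule \<delta>(2)[OF D KU(5)])
  finally have "\<beta> (\<lambda>z. indicator E z - g z) \<le> e" by simp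
  moreover have "approximable g"
    using g(1) by (intro approximable_continuous) (rule continuous_on_subset, auto)
  ultimately show "\<exists>g. approximable g \<and> \<beta> (\<lambda>z. indicator E z - g z) \<le> e" by blast
qed

text \<open>The sum over level sets reproduces \<open>s\<close> only on the circle, so the two are
  compared through \<open>approximable_closed\<close> with an error bounded by 0.\<close>

lemma approximable_simple:
  assumes s: "simple_function circle s"
  shows "approximable s"
proof (rule approximable_closed)
  show sL: "s \<in> L_infinity" using s by (rule L_infinity_simple)
  define g where "g = (\<lambda>z. \<Sum>y\<in>s ` space circle. y * (indicator (s -` {y} \<inter> space circle) z :: complex))"
  have g: "approximable g" unfolding g_def
    using s by (intro approximable_sum approximable_indicator) (auto simp: simple_function_def)
  have "g z = s z" if "z \<in> space circle" for z
  proof -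
    have "g z = (\<Sum>y\<in>s ` space circle. if s z = y then y else 0)"
      unfolding g_def using that by (intro sum.cong) (auto simp: indicator_def)
    then show ?thesis using that s by (simp add: simple_function_def)
  qed
  then have "AE z in circle. cmod (s z - g z) \<le> 0" by auto
  then have "\<beta> (\<lambda>z. s z - g z) \<le> 2 * 0" using g sL
    by (intro \<beta>_le_bound borel_measurable_diff L_infinity_measurable) (auto simp: approximable_def)
  then show "\<exists>g. approximable g \<and> \<beta> (\<lambda>z. s z - g z) \<le> e" if "e > 0" for e
    using g that by (intro exI[of _ g]) auto
qed

lemma approximable_L_infinity:
  assumes f: "f \<in> L_infinity"
  shows "approximable f"
proof (rule approximable_closed[OF f])
  fix e :: real assume e: "e > 0"
  then obtain s where s: "simple_function circle s" "AE z in circle. cmod (f z - s z) \<le> e / 2"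
    using L_infinity_approx_simple[OF f, of "e / 2"] by auto
  have "\<beta> (\<lambda>z. f z - s z) \<le> 2 * (e / 2)"
    using s(2) e
    by (intro \<beta>_le_bound borel_measurable_diff L_infinity_measurable f L_infinity_simple s(1)) auto
  with approximable_simple[OF s(1)] show "\<exists>g. approximable g \<and> \<beta> (\<lambda>z. f z - g z) \<le> e"
    by (intro exI[of _ s]) simp
qed

section \<open>Averages over rotations\<close>

lemma rotate_trig:
  "\<alpha> (\<lambda>z. trig J c (cis t * z)) = \<alpha> (trig J c)"
  using rotate[OF trig_L_infinity, of "cis (- t)" J c] by (simp add: cis_cnj)

lemma trig_rotated_L_infinity: "(\<lambda>z. trig J c (cis t * z)) \<in> L_infinity"
  unfolding trig_def
  by (intro L_infinity_continuous continuous_intros) (auto simp: norm_mult)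

text \<open>Rotating \<open>z\<close> by \<open>cis (t k)\<close> multiplies the \<open>j\<close>-th
  coefficient by \<open>cis (of_int j * t k)\<close>. A weighted sum of rotations is therefore a
  Fourier multiplier, and each rotation has the same \<open>\<alpha>\<close>.\<close>

lemma multiplier_le:
  "\<alpha> (trig J (\<lambda>j. (\<Sum>k<M. w k * cis (of_int j * t k)) * c j)) \<le> (\<Sum>k<M. cmod (w k)) * \<alpha> (trig J c)"
proof -
  have eq: "trig J (\<lambda>j. (\<Sum>k<M. w k * cis (of_int j * t k)) * c j) = (\<lambda>z. \<Sum>k<M. w k * trig J c (cis (t k) * z))"
  proof
    fix z
    have "(\<Sum>k<M. w k * trig J c (cis (t k) * z))
        = (\<Sum>k<M. \<Sum>j\<in>J. w k * cis (of_int j * t k) * c j * z powi j)"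
      by (simp add: trig_def sum_distrib_left power_int_mult_distrib cis_power_int mult_ac)
    also have "\<dots> = trig J (\<lambda>j. (\<Sum>k<M. w k * cis (of_int j * t k)) * c j) z"
      unfolding trig_def by (subst sum.swap) (simp add: sum_distrib_right)
    finally show "trig J (\<lambda>j. (\<Sum>k<M. w k * cis (of_int j * t k)) * c j) z
        = (\<Sum>k<M. w k * trig J c (cis (t k) * z))" ..
  qed
  have "\<alpha> (\<lambda>z. \<Sum>k<M. w k * trig J c (cis (t k) * z)) \<le> (\<Sum>k<M. \<alpha> (\<lambda>z. w k * trig J c (cis (t k) * z)))"
    by (intro sum_le L_infinity_mult L_infinity_const trig_rotated_L_infinity)
  also have "\<dots> = (\<Sum>k<M. cmod (w k)) * \<alpha> (trig J c)"
    by (simp add: scale trig_rotated_L_infinity rotate_trig sum_distrib_right)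
  finally show ?thesis unfolding eq .
qed

text \<open>With uniform weights at the \<open>M\<close>-th roots of unity, and \<open>M\<close>
  above all frequencies, the average of the rotations retains only the constant term, which is the
  integral.\<close>

lemma mean_trig_le:
  assumes "finite J"
  shows "cmod (LINT z|circle. trig J c z) \<le> \<alpha> (trig J c)"
proof -
  \<comment> \<open>Inserting 0 forces \<open>M > 0\<close> even when \<open>J\<close> is
    empty.\<close>
  obtain M :: nat where M: "\<And>j. j \<in> insert 0 J \<Longrightarrow> \<bar>j\<bar> < int M"
    using finite_int_bound[of "insert 0 J"] assms by auto
  from M[of 0] have M0: "M > 0" by simp
  define t where "t k = 2 * pi * real k / real M" for k
  have *: "(\<Sum>k<M. (1 / of_nat M) * cis (of_int j * t k)) = (if j = 0 then 1 else 0)"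
    if "j \<in> J" for j
    using sum_cis_roots_of_unity[of j M] M[of j] that M0
    by (simp add: t_def flip: sum_divide_distrib)
  have "(LINT z|circle. trig J c z) = (\<Sum>j\<in>J. c j * (if j = 0 then 1 else 0))"
    unfolding trig_def
    by (subst Bochner_Integration.integral_sum)
      (auto simp: integral_circle_powi intro!: integrable_mult_right L_infinity_integrable
        L_infinity_continuous continuous_intros)
  also have "\<dots> = trig J (\<lambda>j. (\<Sum>k<M. (1 / of_nat M) * cis (of_int j * t k)) * c j) z" for z
    unfolding trig_def by (intro sum.cong refl) (simp only: *, auto)
  finally have "trig J (\<lambda>j. (\<Sum>k<M. (1 / of_nat M) * cis (of_int j * t k)) * c j)
      = (\<lambda>_. LINT z|circle. trig J c z)" by auto
  with multiplier_le[of J "\<lambda>_. 1 / of_nat M" t M c] M0 show ?thesis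
    by (simp add: const norm_divide)
qed

text \<open>The Fejer kernel at the \<open>M\<close>-th roots of unity is nonnegative, and for \<open>M\<close> large its discrete
  Fourier coefficients agree with \<^const>\<open>fejer\<close>.\<close>

lemma fejer_le:
  assumes "finite J" "n > 0"
  shows "\<alpha> (trig J (\<lambda>j. of_real (fejer n j) * c j)) \<le> \<alpha> (trig J c)"
proof -
  \<comment> \<open>Inserting 0 makes the coefficient formula available at \<open>j = 0\<close>,
    where it yields the total weight.\<close>
  obtain N :: nat where N: "\<And>j. j \<in> insert 0 J \<Longrightarrow> \<bar>j\<bar> < int N"
    using finite_int_bound[of "insert 0 J"] assms by auto
  \<comment> \<open>Every \<open>a - b + j\<close> that occurs then has modulus below
    \<open>M\<close>, so the sums over roots of unity pick out exactly
    \<open>a - b + j = 0\<close>.\<close>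
  define M where "M = N + n"
  have M0: "M > 0" using assms by (simp add: M_def)
  define t where "t k = 2 * pi * real k / real M" for k
  define w where "w k = (cmod (\<Sum>a<n. cis (of_int (int a) * t k)))\<^sup>2 / (real n * real M)" for k
  have w: "of_real (w k) = (\<Sum>a<n. \<Sum>b<n. cis (of_int (int a - int b) * t k)) / (of_nat n * of_nat M)" for k
    unfolding w_def
    by (simp add: complex_norm_square sum_product cis_cnj cis_mult algebra_simps del: of_real_power)
  have *: "(\<Sum>k<M. of_real (w k) * cis (of_int j * t k)) = of_real (fejer n j)" if "j \<in> insert 0 J" for j
  proof -
    have "(\<Sum>k<M. of_real (w k) * cis (of_int j * t k))
        = (\<Sum>k<M. \<Sum>a<n. \<Sum>b<n. cis (of_int (int a - int b + j) * t k)) / (of_nat n * of_nat M)"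
    proof -
      have "cis (of_int (int a - int b) * s) * cis (of_int j * s) = cis (of_int (int a - int b + j) * s)"
        for a b s by (simp add: cis_mult algebra_simps)
      then show ?thesis by (simp add: w sum_distrib_right sum_divide_distrib)
    qed
    also have "(\<Sum>k<M. \<Sum>a<n. \<Sum>b<n. cis (of_int (int a - int b + j) * t k))
        = (\<Sum>a<n. \<Sum>k<M. \<Sum>b<n. cis (of_int (int a - int b + j) * t k))"
      by (rule sum.swap)
    also have "\<dots> = (\<Sum>a<n. \<Sum>b<n. \<Sum>k<M. cis (of_int (int a - int b + j) * t k))"
      by (intro sum.cong refl sum.swap)
    also have "\<dots> = (\<Sum>a<n. \<Sum>b<n. of_nat M * of_bool (int a - int b + j = 0))"
    proof (intro sum.cong refl)
      fix a b assume "a \<in> {..<n}" "b \<in> {..<n}"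
      then have "\<bar>int a - int b + j\<bar> < int M" using N[OF that] by (auto simp: M_def)
      from sum_cis_roots_of_unity[OF this]
      show "(\<Sum>k<M. cis (of_int (int a - int b + j) * t k)) = of_nat M * of_bool (int a - int b + j = 0)"
        by (simp add: t_def)
    qed
    also have "\<dots> = of_nat M * of_real (\<Sum>a<n. \<Sum>b<n. of_bool (int a - int b + j = 0))"
      unfolding sum_distrib_left of_real_sum by (intro sum.cong refl) (simp add: of_bool_def)
    also have "\<dots> / (of_nat n * of_nat M) = of_real (fejer n j)"
      using M0 by (simp add: fejer_def)
    finally show ?thesis .
  qed
  \<comment> \<open>The total weight is the coefficient at 0, and since the weights are nonnegative
    it is also the sum of their moduli.\<close>
  have "complex_of_real (\<Sum>k<M. w k) = 1"
    using *[of 0] assms(2) by (simp add: fejer_eq)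
  then have 1: "(\<Sum>k<M. cmod (of_real (w k))) = 1"
    unfolding norm_of_real by (simp add: w_def flip: of_real_sum)
  have "trig J (\<lambda>j. of_real (fejer n j) * c j) = trig J (\<lambda>j. (\<Sum>k<M. of_real (w k) * cis (of_int j * t k)) * c j)"
    unfolding trig_def by (intro ext sum.cong) (auto simp: *)
  then show ?thesis
    using multiplier_le[of J "\<lambda>k. of_real (w k)" t M c] by (simp only: 1 mult_1)
qed

lemma fejer_tendsto:
  assumes "finite J" "e > 0"
  obtains n where "n > 0" "\<alpha> (\<lambda>z. trig J c z - trig J (\<lambda>j. of_real (fejer n j) * c j) z) < e"
proof -
  obtain N :: nat where N: "\<And>j. j \<in> J \<Longrightarrow> \<bar>j\<bar> < int N"
    using finite_int_bound[OF assms(1)] by auto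
  define S where "S = (\<Sum>j\<in>J. cmod (c j)) * real N"
  have S: "S \<ge> 0" unfolding S_def by (intro mult_nonneg_nonneg sum_nonneg) auto
  \<comment> \<open>\<open>n > N\<close> puts all frequencies where the Fejer weight is
    \<open>1 - \<bar>j\<bar> / n\<close>; \<open>n > S / e\<close> brings the total error
    \<open>S / n\<close> below \<open>e\<close>.\<close>
  obtain n where n: "real n > max (S / e) (real N)" using reals_Archimedean2 by blast
  then have n0: "n > 0" "real n > S / e" "n > N" by auto
  have "cmod (1 - of_real (fejer n j)) \<le> real N / real n" if "j \<in> J" for j
  proof -
    have j: "\<bar>of_int j\<bar> \<le> real N" using N[OF that] by linarith
    then have f: "\<bar>of_int j\<bar> / real n \<le> real N / real n" using n0 by (simp add: divide_right_mono)
    have "1 - complex_of_real (fejer n j) = of_real (1 - fejer n j)" by simp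
    then have "cmod (1 - complex_of_real (fejer n j)) = \<bar>1 - fejer n j\<bar>" by (simp only: norm_of_real)
    also have "\<dots> = \<bar>of_int j\<bar> / real n"
      using j n0 by (simp add: fejer_eq max_def)
    finally show ?thesis using f by simp
  qed
  note b = this
  have "\<alpha> (\<lambda>z. trig J c z - trig J (\<lambda>j. of_real (fejer n j) * c j) z)
      = \<alpha> (\<lambda>z. \<Sum>j\<in>J. (1 - of_real (fejer n j)) * c j * z powi j)"
    by (simp add: trig_def algebra_simps flip: sum_subtractf)
  also have "\<dots> \<le> (\<Sum>j\<in>J. \<alpha> (\<lambda>z. (1 - of_real (fejer n j)) * c j * z powi j))"
    by (intro sum_le L_infinity_continuous continuous_intros) auto
  also have "\<dots> \<le> (\<Sum>j\<in>J. cmod (c j) * (real N / real n))"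
  proof (rule sum_mono)
    fix j assume "j \<in> J"
    then show "\<alpha> (\<lambda>z. (1 - of_real (fejer n j)) * c j * z powi j) \<le> cmod (c j) * (real N / real n)"
      using mult_left_mono[OF b[of j] norm_ge_zero[of "c j"]]
      by (intro le_bound borel_measurable_circle_continuous continuous_intros)
        (auto simp: space_circle norm_mult norm_power_int mult_ac)
  qed
  also have "\<dots> = S / real n" by (simp add: S_def sum_distrib_right sum_divide_distrib)
  also have "\<dots> < e" using n0 assms(2) by (simp add: field_simps)
  finally show thesis using n0(1) that by blast
qed

text \<open>The integral of \<open>\<bar>f\<bar>\<close> is the mean of a bounded function, and
  \<open>mean_trig_le\<close> carries over to it by approximation: closeness in
  \<open>\<beta>\<close> controls the error in \<open>\<alpha>\<close> and in the integral
  together.\<close>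

lemma L1_le:
  assumes f: "f \<in> L_infinity"
  shows "(LINT z|circle. cmod (f z)) \<le> \<alpha> f"
proof (rule field_le_epsilon)
  fix e :: real assume e: "e > 0"
  define g where "g z = complex_of_real (cmod (f z))" for z
  have g: "g \<in> L_infinity" unfolding g_def using f by (rule L_infinity_cmod)
  obtain J c where J: "finite J" "\<beta> (\<lambda>z. g z - trig J c z) < e"
    using approximable_L_infinity[OF g] e unfolding approximable_def by blast
  have L: "(\<lambda>z. g z - trig J c z) \<in> L_infinity" using g trig_L_infinity by (rule L_infinity_diff)
  have "complex_of_real (LINT z|circle. cmod (f z)) = (LINT z|circle. g z)" by (simp add: g_def)
  also have "\<dots> = (LINT z|circle. g z - trig J c z) + (LINT z|circle. trig J c z)"
    using g by (simp add: L_infinity_integrable trig_L_infinity)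
  finally have "complex_of_real (LINT z|circle. cmod (f z)) = \<dots>" .
  then have "\<bar>LINT z|circle. cmod (f z)\<bar>
      = cmod ((LINT z|circle. g z - trig J c z) + (LINT z|circle. trig J c z))"
    by (metis norm_of_real)
  also have "\<dots> \<le> (LINT z|circle. cmod (g z - trig J c z)) + \<alpha> (trig J c)"
    by (rule order_trans[OF norm_triangle_ineq add_mono])
      (use mean_trig_le[OF J(1)] integral_norm_bound in auto)
  also have "\<alpha> (trig J c) \<le> \<alpha> g + \<alpha> (\<lambda>z. trig J c z - g z)"
    using triangle[OF g L_infinity_diff[OF trig_L_infinity g]] by simp
  also have "\<alpha> (\<lambda>z. trig J c z - g z) = \<alpha> (\<lambda>z. g z - trig J c z)"
    using g by (intro minus_commute trig_L_infinity)
  also have "\<alpha> g = \<alpha> f" unfolding g_def using f by (rule cmod_eq)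
  finally show "(LINT z|circle. cmod (f z)) \<le> \<alpha> f + e" using J(2) by (simp add: \<beta>_def)
qed

text \<open>The truncations of \<open>\<bar>f\<bar>\<close> at height \<open>n\<close> are bounded,
  so \<open>L1_le\<close> and \<open>le_extended_norm\<close> apply to them; monotone convergence
  gives the bound for \<open>f\<close>.\<close>

lemma nn_integral_le_extended_norm:
  assumes [measurable]: "f \<in> borel_measurable circle"
  shows "(\<integral>\<^sup>+z. ennreal (cmod (f z)) \<partial>circle) \<le> extended_norm \<alpha> f"
proof -
  define u where "u n z = complex_of_real (min (cmod (f z)) (real n))" for n z
  have [measurable]: "u n \<in> borel_measurable circle" for n unfolding u_def by measurable
  have uL: "u n \<in> L_infinity" for n
    by (rule L_infinityI[of _ "real n"]) (auto simp: u_def min_def)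
  have "ennreal (cmod (f z)) = (SUP n. ennreal (cmod (u n z)))" for z
  proof (rule antisym)
    obtain n where "cmod (f z) \<le> real n" using real_arch_simple by blast
    then have "cmod (u n z) = cmod (f z)" by (simp add: u_def)
    then show "ennreal (cmod (f z)) \<le> (SUP n. ennreal (cmod (u n z)))"
      by (metis SUP_upper UNIV_I)
    show "(SUP n. ennreal (cmod (u n z))) \<le> ennreal (cmod (f z))"
      by (intro SUP_least ennreal_leI) (simp add: u_def)
  qed
  then have "(\<integral>\<^sup>+z. ennreal (cmod (f z)) \<partial>circle) = (\<integral>\<^sup>+z. (SUP n. ennreal (cmod (u n z))) \<partial>circle)"
    by simp
  also have "\<dots> = (SUP n. \<integral>\<^sup>+z. ennreal (cmod (u n z)) \<partial>circle)"
  proof (rule nn_integral_monotone_convergence_SUP)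
    show "incseq (\<lambda>n z. ennreal (cmod (u n z)))"
      by (intro incseq_SucI le_funI ennreal_leI) (auto simp: u_def)
  qed measurable
  also have "\<dots> \<le> extended_norm \<alpha> f"
  proof (rule SUP_least)
    fix n
    have "(\<integral>\<^sup>+z. ennreal (cmod (u n z)) \<partial>circle) = ennreal (LINT z|circle. cmod (u n z))"
      using uL by (intro nn_integral_eq_integral integrable_norm L_infinity_integrable) auto
    also have "\<dots> \<le> ennreal (\<alpha> (u n))" by (intro ennreal_leI L1_le uL)
    also have "\<dots> \<le> extended_norm \<alpha> f" by (rule le_extended_norm[OF uL]) (simp add: u_def)
    finally show "(\<integral>\<^sup>+z. ennreal (cmod (u n z)) \<partial>circle) \<le> extended_norm \<alpha> f" .
  qed
  finally show ?thesis .
qed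

lemma script_L_integrable: "f \<in> script_L \<alpha> \<Longrightarrow> integrable circle f"
  using nn_integral_le_extended_norm[of f]
  by (auto simp: script_L_def integrable_iff_bounded intro: le_less_trans)

text \<open>Makes Fourier coefficients continuous for the extended norm: multiplying by a character
  does not change the modulus on the circle.\<close>

lemma norm_integral_mult_powi_le:
  assumes h: "h \<in> borel_measurable circle" "extended_norm \<alpha> h < ennreal e"
  shows "cmod (LINT z|circle. h z * z powi k) < e"
proof -
  have "h \<in> script_L \<alpha>" using h by (auto simp: script_L_def intro: less_trans)
  then have hi: "integrable circle h" by (rule script_L_integrable)
  have "ennreal (cmod (LINT z|circle. h z * z powi k)) \<le> (\<integral>\<^sup>+z. ennreal (cmod (h z * z powi k)) \<partial>circle)"
    by (rule integral_norm_bound_ennreal) (rule Bochner_Integration.integrable_bound[OF hi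
        borel_measurable_times[OF h(1) borel_measurable_circle_continuous[OF continuous_on_circle_powi]]],
      auto simp: space_circle norm_mult norm_power_int)
  also have "\<dots> = (\<integral>\<^sup>+z. ennreal (cmod (h z)) \<partial>circle)"
    by (intro nn_integral_cong) (auto simp: space_circle norm_mult norm_power_int)
  also have "\<dots> \<le> extended_norm \<alpha> h" by (rule nn_integral_le_extended_norm[OF h(1)])
  also note h(2)
  finally show ?thesis by (simp add: ennreal_less_iff)
qed

end

section \<open>The Hardy space\<close>

text \<open>\<open>complex_span\<close> attaches coefficients to functions rather than to exponents,
  so distinct exponents must give distinct functions; evaluation at 2, off the circle, shows
  this.\<close>

lemma monomial_span_poly:
  "(\<lambda>z. \<Sum>i<n. a i * z ^ i) \<in> complex_span (range (\<lambda>n::nat. \<lambda>z. z ^ n))"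
proof -
  define m where "m n z = z ^ n" for n :: nat and z :: complex
  have inj: "inj m"
  proof (rule injI)
    fix i j assume "m i = m j"
    from fun_cong[OF this, of 2] have "(of_nat (2 ^ i) :: complex) = of_nat (2 ^ j)"
      by (simp add: m_def)
    then have "(2::nat) ^ i = 2 ^ j" by (simp only: of_nat_eq_iff)
    then show "i = j" by simp
  qed
  have "(\<lambda>z. \<Sum>i<n. a i * z ^ i) = (\<lambda>z. \<Sum>b\<in>m ` {..<n}. a (inv m b) * b z)"
    by (subst sum.reindex) (auto simp: inj inv_f_f[OF inj] inj_on_subset[OF inj] m_def)
  then have "(\<lambda>z. \<Sum>i<n. a i * z ^ i) \<in> complex_span (range m)"
    unfolding complex_span_def
    by (intro CollectI exI[of _ "m ` {..<n}"] exI[of _ "\<lambda>b. a (inv m b)"]) auto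
  then show ?thesis by (simp add: m_def[abs_def])
qed

lemma monomial_span_continuous:
  assumes "g \<in> complex_span (range (\<lambda>n::nat. \<lambda>z. z ^ n))"
  shows "continuous_on S g"
proof -
  from assms obtain F c where F: "finite F" "F \<subseteq> range (\<lambda>n::nat. \<lambda>z::complex. z ^ n)"
    and g: "g = (\<lambda>z. \<Sum>b\<in>F. c b * b z)" unfolding complex_span_def by blast
  show ?thesis unfolding g using F(2) by (auto intro!: continuous_intros)
qed

lemma monomial_span_integral:
  assumes "g \<in> complex_span (range (\<lambda>n::nat. \<lambda>z. z ^ n))" "k > 0"
  shows "(LINT z|circle. g z * z powi k) = 0"
proof -
  from assms(1) obtain F c where F: "finite F" "F \<subseteq> range (\<lambda>n::nat. \<lambda>z::complex. z ^ n)"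
    and g: "g = (\<lambda>z. \<Sum>b\<in>F. c b * b z)" unfolding complex_span_def by blast
  have "(LINT z|circle. b z * z powi k) = 0" if b: "b \<in> F" for b
  proof -
    obtain n where "b = (\<lambda>z. z ^ n)" using F(2) b by blast
    then have "(LINT z|circle. b z * z powi k) = (LINT z|circle. z powi (int n + k))"
      by (intro Bochner_Integration.integral_cong) (auto simp: space_circle circle_powi_add)
    then show ?thesis using assms(2) by (simp add: integral_circle_powi)
  qed
  moreover have "integrable circle (\<lambda>z. b z * z powi k)" if b: "b \<in> F" for b
  proof -
    obtain n where "b = (\<lambda>z. z ^ n)" using F(2) b by blast
    then show ?thesis
      by (auto intro!: L_infinity_integrable L_infinity_continuous continuous_intros)
  qed
  ultimately show ?thesis
    by (simp add: g sum_distrib_right mult.assoc Bochner_Integration.integral_sum)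
qed

lemma trig_coeff:
  assumes "finite J" "i \<in> J"
  shows "(LINT z|circle. trig J c z * z powi (- i)) = c i"
proof -
  have "(LINT z|circle. trig J c z * z powi (- i)) = (LINT z|circle. (\<Sum>j\<in>J. c j * z powi (j + - i)))"
    by (intro Bochner_Integration.integral_cong)
      (auto simp: trig_def space_circle sum_distrib_right circle_powi_add mult.assoc simp del: add_uminus_conv_diff)
  also have "\<dots> = (\<Sum>j\<in>J. c j * (if j + - i = 0 then 1 else 0))"
    by (subst Bochner_Integration.integral_sum)
      (auto simp: integral_circle_powi intro!: integrable_mult_right L_infinity_integrable
        L_infinity_continuous continuous_intros)
  also have "\<dots> = c i" using assms by (simp add: if_distrib cong: if_cong)
  finally show ?thesis .
qed

section \<open>The two inclusions\<close>

context crs_norm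
begin

lemma script_LD: "f \<in> script_L \<alpha> \<Longrightarrow> f \<in> borel_measurable circle"
  by (simp add: script_L_def)

text \<open>Coefficients of negative index vanish on the span of the monomials and are continuous
  for the extended norm, hence vanish on the closure.\<close>

lemma H_alpha_subset: "H_alpha \<alpha> \<subseteq> L_alpha \<alpha> \<inter> H_one"
proof
  fix f assume "f \<in> H_alpha \<alpha>"
  then have f: "f \<in> script_L \<alpha>" and app: "\<And>e. e > 0 \<Longrightarrow>
      \<exists>g\<in>complex_span (range (\<lambda>n::nat. \<lambda>z. z ^ n)). extended_norm \<alpha> (\<lambda>z. f z - g z) < ennreal e"
    unfolding H_alpha_def norm_closure_def by auto
  have span_L: "g \<in> L_infinity" if "g \<in> complex_span (range (\<lambda>n::nat. \<lambda>z. z ^ n))" for g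
    by (rule L_infinity_continuous[OF monomial_span_continuous[OF that]])
  have "f \<in> L_alpha \<alpha>"
    unfolding L_alpha_def norm_closure_def using f app span_L by blast
  moreover have "(LINT z|circle. f z * z powi (- n)) = 0" if "n < 0" for n
  proof (rule ccontr)
    assume *: "(LINT z|circle. f z * z powi (- n)) \<noteq> 0"
    \<comment> \<open>The tolerance is the modulus of the coefficient itself, which
      \<open>f - g\<close> still has in full because that of \<open>g\<close> is 0.\<close>
    then obtain g where g: "g \<in> complex_span (range (\<lambda>n::nat. \<lambda>z. z ^ n))"
      "extended_norm \<alpha> (\<lambda>z. f z - g z) < ennreal (cmod (LINT z|circle. f z * z powi (- n)))"
      using app by (meson zero_less_norm_iff)
    note gL = span_L[OF g(1)]
    have meas: "(\<lambda>z. z powi (- n)) \<in> borel_measurable circle"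
      by (intro borel_measurable_circle_continuous continuous_on_circle_powi)
    have int: "integrable circle (\<lambda>z. h z * z powi (- n))" if "integrable circle h" for h
      by (rule Bochner_Integration.integrable_bound[OF that])
        (use that meas in \<open>auto simp: space_circle norm_mult norm_power_int\<close>)
    have "(LINT z|circle. (f z - g z) * z powi (- n))
        = (LINT z|circle. f z * z powi (- n)) - (LINT z|circle. g z * z powi (- n))"
      using int[OF script_L_integrable[OF f]] int[OF L_infinity_integrable[OF gL]]
      by (simp add: left_diff_distrib)
    also have "(LINT z|circle. g z * z powi (- n)) = 0"
      using g(1) that by (intro monomial_span_integral) auto
    finally show False
      using norm_integral_mult_powi_le[OF _ g(2), of "- n"] script_LD[OF f] L_infinity_measurable[OF gL]
      by simp
  qed
  ultimately show "f \<in> L_alpha \<alpha> \<inter> H_one"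
    using script_L_integrable[OF f] by (auto simp: H_one_def)
qed

text \<open>Two approximations in a row: a bounded \<open>g\<close> by definition of
  \<open>L_alpha\<close>, then a trigonometric polynomial close to \<open>g\<close> in
  \<open>\<beta>\<close>, which dominates \<open>\<alpha>\<close>.\<close>

lemma L_alpha_approx_trig:
  assumes "f \<in> L_alpha \<alpha>" "e > 0"
  obtains J c where "finite J" "extended_norm \<alpha> (\<lambda>z. f z - trig J c z) < ennreal e"
proof -
  from assms obtain g where f: "f \<in> script_L \<alpha>" and g: "g \<in> L_infinity"
    "extended_norm \<alpha> (\<lambda>z. f z - g z) < ennreal (e / 2)"
    unfolding L_alpha_def norm_closure_def by (auto dest!: spec[of _ "e / 2"])
  obtain J c where J: "finite J" "\<beta> (\<lambda>z. g z - trig J c z) < e / 2"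
    using approximable_L_infinity[OF g(1)] assms(2) unfolding approximable_def by (meson half_gt_zero)
  note [measurable] = script_LD[OF f] L_infinity_measurable[OF g(1)] L_infinity_measurable[OF trig_L_infinity]
  have L: "(\<lambda>z. g z - trig J c z) \<in> L_infinity" using g(1) trig_L_infinity by (rule L_infinity_diff)
  have "0 \<le> (LINT z|circle. cmod (g z - trig J c z))" by simp
  then have "\<alpha> (\<lambda>z. g z - trig J c z) < e / 2" using J(2) unfolding \<beta>_def by linarith
  then have "extended_norm \<alpha> (\<lambda>z. g z - trig J c z) < ennreal (e / 2)"
    using nonneg[OF L] by (simp add: extended_norm_eq[OF L] ennreal_less_iff)
  note small = this
  have "extended_norm \<alpha> (\<lambda>z. f z - trig J c z)
      \<le> extended_norm \<alpha> (\<lambda>z. f z - g z) + extended_norm \<alpha> (\<lambda>z. g z - trig J c z)"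
    using extended_norm_triangle[of "\<lambda>z. f z - g z" "\<lambda>z. g z - trig J c z"] by simp
  also have "\<dots> < ennreal (e / 2) + ennreal (e / 2)"
    using g(2) small by (rule add_strict_mono)
  also have "\<dots> = ennreal e" using assms(2) by (simp flip: ennreal_plus)
  finally show thesis by (rule that[OF J(1)])
qed

lemma subset_H_alpha: "L_alpha \<alpha> \<inter> H_one \<subseteq> H_alpha \<alpha>"
proof
  fix f assume "f \<in> L_alpha \<alpha> \<inter> H_one"
  then have fL: "f \<in> L_alpha \<alpha>" and fH: "f \<in> H_one" by auto
  have f: "f \<in> script_L \<alpha>" using fL by (simp add: L_alpha_def norm_closure_def)
  note [measurable] = script_LD[OF f]
  have "\<exists>g\<in>complex_span (range (\<lambda>n::nat. \<lambda>z. z ^ n)). extended_norm \<alpha> (\<lambda>z. f z - g z) < ennreal \<epsilon>"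
    if "\<epsilon> > 0" for \<epsilon>
  proof -
    \<comment> \<open>Of the four parts, one goes to \<open>f - p\<close> and three to
      \<open>p - r\<close>.\<close>
    define e where "e = \<epsilon> / 4"
    have e: "e > 0" using that by (simp add: e_def)
    obtain J c where J: "finite J" "extended_norm \<alpha> (\<lambda>z. f z - trig J c z) < ennreal e"
      using L_alpha_approx_trig[OF fL e] .
    obtain n where n: "n > 0" "\<alpha> (\<lambda>z. trig J c z - trig J (\<lambda>j. of_real (fejer n j) * c j) z) < e"
      using fejer_tendsto[OF J(1) e] .
    \<comment> \<open>\<open>n\<close> is already fixed here. One \<open>d\<close> enters through
      the distance of \<open>q\<close> from \<open>f\<close>, and \<open>n\<close> more through the
      negative frequencies; together they make \<open>e\<close>.\<close>
    define d where "d = e / real (n + 1)"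
    have d: "d > 0" using e by (simp add: d_def)
    obtain K b where K: "finite K" "extended_norm \<alpha> (\<lambda>z. f z - trig K b z) < ennreal d"
      using L_alpha_approx_trig[OF fL d] .
    \<comment> \<open>The common frequency set includes the whole window in which
      \<open>fejer n\<close> is nonzero, so that sums can be restricted to it.\<close>
    define L where "L = J \<union> K \<union> {- int n<..<int n}"
    define c' where "c' j = (if j \<in> J then c j else 0)" for j
    define b' where "b' j = (if j \<in> K then b j else 0)" for j
    have L: "finite L" "J \<subseteq> L" "K \<subseteq> L" "{- int n<..<int n} \<subseteq> L" using J(1) K(1) by (auto simp: L_def)
    \<comment> \<open>\<open>sp\<close> and \<open>sq\<close> are the Cesaro means of
      \<open>p\<close> and \<open>q\<close>, and \<open>r\<close> is the analytic part of
      \<open>sq\<close>.\<close>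
    define p q sp sq r where "p = trig L c'" and "q = trig L b'"
      and "sp = trig L (\<lambda>j. of_real (fejer n j) * c' j)"
      and "sq = trig L (\<lambda>j. of_real (fejer n j) * b' j)"
      and "r = (\<lambda>z. \<Sum>i<n. (of_real (fejer n (int i)) * b' (int i)) * z ^ i)"
    have pL: "p \<in> L_infinity" "q \<in> L_infinity" "sp \<in> L_infinity" "sq \<in> L_infinity"
      by (auto simp: p_def q_def sp_def sq_def)
    have rL: "r \<in> L_infinity" unfolding r_def by (intro L_infinity_continuous continuous_intros)
    note [measurable] = pL[THEN L_infinity_measurable] rL[THEN L_infinity_measurable]
    have p: "trig J c = p" and q: "trig K b = q"
      unfolding p_def q_def c'_def b'_def using trig_extend L by blast+
    have "trig J (\<lambda>j. of_real (fejer n j) * c j) = sp"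
      unfolding sp_def c'_def using trig_extend[OF L(1,2)] by (auto simp: if_distrib cong: if_cong)
    with n(2) have p_sp: "\<alpha> (\<lambda>z. p z - sp z) < e" by (simp add: p)
    have fp: "extended_norm \<alpha> (\<lambda>z. f z - p z) < ennreal e" using J(2) by (simp add: p)
    have fq: "extended_norm \<alpha> (\<lambda>z. f z - q z) < ennreal d" using K(2) by (simp add: q)

    have pqL: "(\<lambda>z. p z - q z) \<in> L_infinity" using pL by (intro L_infinity_diff)
    have "ennreal (\<alpha> (\<lambda>z. p z - q z)) = extended_norm \<alpha> (\<lambda>z. (p z - f z) + (f z - q z))"
      using extended_norm_eq[OF pqL] by simp
    also have "\<dots> \<le> extended_norm \<alpha> (\<lambda>z. p z - f z) + extended_norm \<alpha> (\<lambda>z. f z - q z)"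
      by (rule extended_norm_triangle) measurable
    also have "\<dots> < ennreal e + ennreal d"
      using fp fq by (intro add_strict_mono) (simp_all add: extended_norm_minus_commute[of _ p f])
    also have "\<dots> = ennreal (e + d)" using e d by simp
    finally have pq: "\<alpha> (\<lambda>z. p z - q z) < e + d"
      using nonneg[OF pqL] by (simp add: ennreal_less_iff)
    \<comment> \<open>The Cesaro mean is linear, so \<open>fejer_le\<close> applied to
      \<open>p - q\<close> bounds the distance between the means.\<close>
    have "\<alpha> (trig L (\<lambda>j. of_real (fejer n j) * (c' j - b' j))) \<le> \<alpha> (trig L (\<lambda>j. c' j - b' j))"
      by (rule fejer_le[OF L(1) n(1)])
    also have "trig L (\<lambda>j. c' j - b' j) = (\<lambda>z. p z - q z)"
      by (auto simp: p_def q_def trig_def left_diff_distrib sum_subtractf)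
    also have "trig L (\<lambda>j. of_real (fejer n j) * (c' j - b' j)) = (\<lambda>z. sp z - sq z)"
      by (auto simp: sp_def sq_def trig_def left_diff_distrib right_diff_distrib sum_subtractf)
    finally have sp_sq: "\<alpha> (\<lambda>z. sp z - sq z) < e + d" using pq by simp

    have coeff: "cmod (b' j) < d" if "j \<in> L" "j < 0" for j
    proof -
      have meas: "(\<lambda>z. z powi (- j)) \<in> borel_measurable circle"
        by (intro borel_measurable_circle_continuous continuous_on_circle_powi)
      have int: "integrable circle (\<lambda>z. h z * z powi (- j))" if "integrable circle h" for h
        by (rule Bochner_Integration.integrable_bound[OF that])
          (use that meas in \<open>auto simp: space_circle norm_mult norm_power_int\<close>)
      \<comment> \<open>For \<open>j < 0\<close> the coefficient of \<open>f\<close> is 0 because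
        \<open>f\<close> is in \<open>H_one\<close>, so \<open>b' j\<close> is a coefficient of the
        small function \<open>q - f\<close>.\<close>
      have "(LINT z|circle. (q z - f z) * z powi (- j))
          = (LINT z|circle. q z * z powi (- j)) - (LINT z|circle. f z * z powi (- j))"
        using int[OF script_L_integrable[OF f]] int[OF L_infinity_integrable[OF pL(2)]]
        by (simp add: left_diff_distrib)
      also have "\<dots> = b' j"
        using trig_coeff[OF L(1) that(1), of b'] fH that(2) by (simp add: H_one_def q_def)
      finally show ?thesis
        using norm_integral_mult_powi_le[of "\<lambda>z. q z - f z" d "- j"] fq
        by (simp add: extended_norm_minus_commute[of _ q f])
    qed
    \<comment> \<open>Outside the window the Fejer weights vanish, and \<open>r\<close> takes the
      nonnegative frequencies. This leaves \<open>n - 1\<close> negative ones, each contributing at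
      most \<open>d\<close>.\<close>
    have sq_r: "cmod (sq z - r z) \<le> real n * d" if z: "z \<in> sphere 0 1" for z
    proof -
      let ?t = "\<lambda>j. of_real (fejer n j) * b' j * z powi j"
      have "sq z = (\<Sum>j\<in>{- int n<..<int n}. ?t j)"
        unfolding sq_def trig_def
      proof (rule sum.mono_neutral_right[OF L(1,4)], rule ballI)
        fix j assume "j \<in> L - {- int n<..<int n}"
        then have "real n \<le> \<bar>of_int j\<bar>" by auto
        then have "fejer n j = 0" using n(1) by (simp add: fejer_eq)
        then show "?t j = 0" by simp
      qed
      also have "{- int n<..<int n} = {- int n<..<0} \<union> {0..<int n}" using n(1) by auto
      also have "(\<Sum>j\<in>\<dots>. ?t j) = (\<Sum>j\<in>{- int n<..<0}. ?t j) + (\<Sum>j\<in>{0..<int n}. ?t j)"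
        by (rule sum.union_disjoint) auto
      also have "{0..<int n} = int ` {..<n}" by (auto simp: image_iff intro!: bexI[of _ "nat _"])
      also have "(\<Sum>j\<in>\<dots>. ?t j) = r z" by (subst sum.reindex) (auto simp: r_def)
      finally have "sq z - r z = (\<Sum>j\<in>{- int n<..<0}. ?t j)" by simp
      then have "cmod (sq z - r z) = cmod (\<Sum>j\<in>{- int n<..<0}. ?t j)" by simp
      also have "\<dots> \<le> of_nat (card {- int n<..<0}) * d"
      proof (rule sum_norm_bound)
        fix j assume j: "j \<in> {- int n<..<0}"
        have "cmod (?t j) = \<bar>fejer n j\<bar> * cmod (b' j)"
          using z by (simp add: norm_mult norm_power_int)
        moreover have "j \<in> L" using j L(4) by auto
        ultimately have "cmod (?t j) = \<bar>fejer n j\<bar> * cmod (b' j)" "cmod (b' j) < d"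
          using coeff[of j] j by auto
        note this(1)
        also have "\<bar>fejer n j\<bar> * cmod (b' j) \<le> 1 * d"
          using \<open>cmod (b' j) < d\<close> n(1) by (intro mult_mono) (auto simp: fejer_eq)
        finally show "cmod (?t j) \<le> d" by simp
      qed
      also have "\<dots> \<le> real n * d" using d by (intro mult_right_mono) auto
      finally show ?thesis .
    qed
    then have sq_r: "\<alpha> (\<lambda>z. sq z - r z) \<le> real n * d"
      using d by (intro le_bound) (auto simp: space_circle)
    have prL: "(\<lambda>z. p z - r z) \<in> L_infinity" using pL rL by (intro L_infinity_diff)
    have "\<alpha> (\<lambda>z. p z - r z) = \<alpha> (\<lambda>z. (p z - sp z) + ((sp z - sq z) + (sq z - r z)))" by simp
    also have "\<dots> \<le> \<alpha> (\<lambda>z. p z - sp z) + \<alpha> (\<lambda>z. (sp z - sq z) + (sq z - r z))"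
      by (intro triangle L_infinity_diff L_infinity_add pL rL)
    also have "\<alpha> (\<lambda>z. (sp z - sq z) + (sq z - r z)) \<le> \<alpha> (\<lambda>z. sp z - sq z) + \<alpha> (\<lambda>z. sq z - r z)"
      by (intro triangle L_infinity_diff pL rL)
    finally have "\<alpha> (\<lambda>z. p z - r z) < e + (e + d) + real n * d"
      using p_sp sp_sq sq_r by linarith
    also have "\<dots> = 2 * e + (real n + 1) * d" by (simp add: algebra_simps)
    also have "(real n + 1) * d = e" by (simp add: d_def add_nonneg_eq_0_iff divide_simps)
    finally have pr: "extended_norm \<alpha> (\<lambda>z. p z - r z) < ennreal (3 * e)"
      using nonneg[OF prL] by (simp add: extended_norm_eq[OF prL] ennreal_less_iff)
    have "extended_norm \<alpha> (\<lambda>z. f z - r z) = extended_norm \<alpha> (\<lambda>z. (f z - p z) + (p z - r z))" by simp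
    also have "\<dots> \<le> extended_norm \<alpha> (\<lambda>z. f z - p z) + extended_norm \<alpha> (\<lambda>z. p z - r z)"
      by (rule extended_norm_triangle) measurable
    also have "\<dots> < ennreal e + ennreal (3 * e)" using fp pr by (rule add_strict_mono)
    also have "\<dots> = ennreal \<epsilon>" using e by (simp add: e_def flip: ennreal_plus)
    finally have "extended_norm \<alpha> (\<lambda>z. f z - r z) < ennreal \<epsilon>" .
    moreover have "r \<in> complex_span (range (\<lambda>n::nat. \<lambda>z. z ^ n))"
      unfolding r_def by (rule monomial_span_poly)
    ultimately show ?thesis by (intro bexI[of _ r])
  qed
  with f show "f \<in> H_alpha \<alpha>" by (simp add: H_alpha_def norm_closure_def)
qed

end

theorem corollary6p2:
  fixes \<alpha> :: "(complex \<Rightarrow> complex) \<Rightarrow> real"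
  assumes "continuous_rotationally_symmetric_norm \<alpha>"
  shows "H_alpha \<alpha> = L_alpha \<alpha> \<inter> H_one"
proof -
  interpret crs_norm \<alpha> by standard fact
  show ?thesis using H_alpha_subset subset_H_alpha by blast
qed

end
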